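(* For any finite-dimensional Banach space $E$, $$\gamma(E)=K_G^+(E,\ell_2^{\dim E})=\sup\{K_G^+(E,\ell_2^n):n\ge1\}=\|\mathrm{id}\|^2_{B(E,\ell_2)\to\Pi_2(E,\ell_2)},$$ where $\|\mathrm{id}\|_{B(E,\ell_2)\to\Pi_2(E,\ell_2)}=\sup\{\pi_2(u): u\in B(E,\ell_2),\ \|u\|\le1\}$.
   Context: Banach spaces are real. $E\check\otimes F$, $E\hat\otimes F$ denote the injective and projective tensor products. Positivity: an element of $E\otimes E$ is nonnegative ($\ge0$) if it is in the convex hull of $\{x\otimes x:x\in E\}$; likewise for $E^*\otimes E^*$. Linear maps $E\to E^*$ are identified with elements of $E^*\otimes E^*$, with operator norm equal to the injective norm. $\gamma(E)$ is the infimum of all $c$ such that $\langle A,B\rangle\le c\|A\|_{E\check\otimes E}\|B\|_{E^*\check\otimes E^*}$ for all $A\in E\otimes E$, $B\in E^*\otimes E^*$ with $A\ge0$, $B\ge0$, where $\langle\cdot,\cdot\rangle$ is the natural (Hilbert–Schmidt/trace) pairing $\langle e\otimes f,e^*\otimes f^*\rangle=e^*(e)f^*(f)$. $$K_G^+(E,F)=\sup\{\|A\otimes\mathrm{id}_F\|_{E\check\otimes F\to E^*\hat\otimes F}: A:E\to E^*,\ A\ge0,\ \|A\|_{E\to E^*}\le1\}.$$ $B(E,\ell_2)$ is the space of bounded operators with operator norm; $\Pi_2(E,\ell_2)$ is the space of $2$-summing operators with the $2$-summing norm $\pi_2$, where $\pi_2(u)$ is the least $C$ with $(\sum\|ux_i\|^2)^{1/2}\le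 C\sup\{(\sum|x^*(x_i)|^2)^{1/2}:\|x^*\|_{E^*}\le1\}$ for all finite sequences $(x_i)$. *)

theory Defs
  imports "HOL-Analysis.Analysis"
begin

section \<open>The algebraic tensor product of real vector spaces\<close>

text \<open>Elements are finite formal sums of pairs. Two formal sums define the same tensor iff no
  bilinear form distinguishes them; over a field this is exactly the kernel of the canonical map from
  the free vector space on pairs onto the tensor product.\<close>

definition tensor_sum :: "('a \<Rightarrow> 'b \<Rightarrow> 'c::real_vector) \<Rightarrow> ('a \<times> 'b) list \<Rightarrow> 'c" where
  "tensor_sum f ps = (\<Sum>(x, y)\<leftarrow>ps. f x y)"

definition tensor_eq ::
    "('a::real_vector \<times> 'b::real_vector) list \<Rightarrow> ('a \<times> 'b) list \<Rightarrow> bool" where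
  "tensor_eq ps qs \<longleftrightarrow>
     (\<forall>b :: 'a \<Rightarrow> 'b \<Rightarrow> real. bilinear b \<longrightarrow> tensor_sum b ps = tensor_sum b qs)"

lemma tensor_sum_simps [simp]:
  "tensor_sum f [] = 0"
  "tensor_sum f ((x, y) # ps) = f x y + tensor_sum f ps"
  "tensor_sum f (ps @ qs) = tensor_sum f ps + tensor_sum f qs"
  by (simp_all add: tensor_sum_def)

quotient_type (overloaded) ('a, 'b) tensor =
    "('a::real_vector \<times> 'b::real_vector) list" / tensor_eq
  by (rule equivpI) (auto simp: reflp_def symp_def transp_def tensor_eq_def)

lemma tensor_sum_scale_left:
  "bilinear f \<Longrightarrow> tensor_sum f (map (\<lambda>(x, y). (r *\<^sub>R x, y)) ps) = r *\<^sub>R tensor_sum f ps"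
  by (induction ps) (auto simp: bilinear_lmul scaleR_add_right)

instantiation tensor :: (real_vector, real_vector) real_vector
begin

lift_definition zero_tensor :: "('a, 'b) tensor" is "[]" .

lift_definition plus_tensor :: "('a, 'b) tensor \<Rightarrow> ('a, 'b) tensor \<Rightarrow> ('a, 'b) tensor" is "(@)"
  by (simp add: tensor_eq_def)

lift_definition scaleR_tensor :: "real \<Rightarrow> ('a, 'b) tensor \<Rightarrow> ('a, 'b) tensor"
  is "\<lambda>r. map (\<lambda>(x, y). (r *\<^sub>R x, y))"
  by (simp add: tensor_eq_def tensor_sum_scale_left)

definition uminus_tensor :: "('a, 'b) tensor \<Rightarrow> ('a, 'b) tensor" where
  "uminus_tensor t = (-1) *\<^sub>R t"

definition minus_tensor :: "('a, 'b) tensor \<Rightarrow> ('a, 'b) tensor \<Rightarrow> ('a, 'b) tensor" where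
  "minus_tensor s t = s + (-1) *\<^sub>R t"

instance
proof
  fix a b c :: "('a, 'b) tensor" and r s :: real
  show "a + b + c = a + (b + c)" by transfer (simp add: tensor_eq_def)
  show "a + b = b + a" by transfer (simp add: tensor_eq_def)
  show "0 + a = a" by transfer (simp add: tensor_eq_def)
  show "- a + a = 0"
    unfolding uminus_tensor_def
    by transfer (simp add: tensor_eq_def tensor_sum_scale_left
        del: scaleR_minus_left scaleR_minus1_left)
  show "a - b = a + - b" by (simp add: uminus_tensor_def minus_tensor_def)
  show "r *\<^sub>R (a + b) = r *\<^sub>R a + r *\<^sub>R b"
    by transfer (simp add: tensor_eq_def tensor_sum_scale_left)
  show "(r + s) *\<^sub>R a = r *\<^sub>R a + s *\<^sub>R a"
    by transfer (simp add: tensor_eq_def tensor_sum_scale_left distrib_right)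
  show "r *\<^sub>R s *\<^sub>R a = (r * s) *\<^sub>R a"
    by transfer (simp add: tensor_eq_def tensor_sum_scale_left mult.assoc del: map_map)
  show "1 *\<^sub>R a = a"
    by transfer (simp add: tensor_eq_def tensor_sum_scale_left)
qed

end

lift_definition tensor_of :: "'a::real_vector \<Rightarrow> 'b::real_vector \<Rightarrow> ('a, 'b) tensor"
    (infixl "\<otimes>" 70)
  is "\<lambda>x y. [(x, y)]" .

lemma linear_functional_separates:
  fixes v :: "'c::real_vector"
  assumes "\<And>f :: 'c \<Rightarrow> real. linear f \<Longrightarrow> f v = 0"
  shows "v = 0"
proof (rule ccontr)
  assume "v \<noteq> 0"
  then have "independent {v}" by simp
  from linear_independent_extend[OF this, of "\<lambda>_. 1 :: real"] obtain g :: "'c \<Rightarrow> real"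
    where "linear g" "g v = 1" by auto
  with assms[of g] show False by simp
qed

lemma tensor_sum_linear:
  assumes "linear g"
  shows "g (tensor_sum f ps) = tensor_sum (\<lambda>x y. g (f x y)) ps"
  by (induction ps) (auto simp: linear_0[OF assms] linear_add[OF assms])

lemma bilinearI:
  assumes "\<And>x x' y. f (x + x') y = f x y + f x' y" "\<And>x y y'. f x (y + y') = f x y + f x y'"
    and "\<And>r x y. f (r *\<^sub>R x) y = r *\<^sub>R f x y" "\<And>r x y. f x (r *\<^sub>R y) = r *\<^sub>R f x y"
  shows "bilinear f"
  using assms by (simp add: bilinear_def linearI)

lemma bilinear_comp_linear:
  assumes "bilinear f" "linear g"
  shows "bilinear (\<lambda>x y. g (f x y))"
  using assms(1)
  by (intro bilinearI) (simp_all add: bilinear_ladd bilinear_radd bilinear_lmul bilinear_rmul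
      linear_add[OF assms(2)] linear_scale[OF assms(2)])

lemma tensor_eq_lift:
  fixes f :: "'a::real_vector \<Rightarrow> 'b::real_vector \<Rightarrow> 'c::real_vector"
  assumes "tensor_eq ps qs" "bilinear f"
  shows "tensor_sum f ps = tensor_sum f qs"
proof -
  have "g (tensor_sum f ps - tensor_sum f qs) = 0" if "linear g" for g :: "'c \<Rightarrow> real"
    using assms(1) bilinear_comp_linear[OF assms(2) that]
    by (simp add: linear_diff[OF that] tensor_sum_linear[OF that] tensor_eq_def)
  then have "tensor_sum f ps - tensor_sum f qs = 0"
    by (rule linear_functional_separates)
  then show ?thesis by simp
qed

text \<open>The linear map induced by a bilinear map (universal property), with junk value \<open>0\<close> if the
  argument is not bilinear.\<close>

lift_definition tensor_lift ::
    "('a::real_vector \<Rightarrow> 'b::real_vector \<Rightarrow> 'c::real_vector) \<Rightarrow> ('a, 'b) tensor \<Rightarrow> 'c"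
  is "\<lambda>f ps. if bilinear f then tensor_sum f ps else 0"
  by (auto intro: tensor_eq_lift)

lemma tensor_lift_tensor_of: "bilinear f \<Longrightarrow> tensor_lift f (x \<otimes> y) = f x y"
  by transfer simp

lemma linear_tensor_lift: "linear (tensor_lift f)"
proof (rule linearI)
  show "tensor_lift f (s + t) = tensor_lift f s + tensor_lift f t" for s t
    by transfer simp
  show "tensor_lift f (r *\<^sub>R t) = r *\<^sub>R tensor_lift f t" for r t
    by transfer (simp add: tensor_sum_scale_left)
qed

lemma bilinear_tensor_of: "bilinear (\<otimes>)"
proof -
  have "x \<otimes> (y + y') = x \<otimes> y + x \<otimes> y'" "(x + x') \<otimes> y = x \<otimes> y + x' \<otimes> y"
    "x \<otimes> (r *\<^sub>R y) = r *\<^sub>R (x \<otimes> y)" "(r *\<^sub>R x) \<otimes> y = r *\<^sub>R (x \<otimes> y)"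
    for x x' :: 'a and y y' :: 'b and r
    by (transfer, simp add: tensor_eq_def bilinear_ladd bilinear_radd bilinear_lmul bilinear_rmul)+
  then show ?thesis by (auto simp: bilinear_def intro!: linearI)
qed

lemma Abs_tensor_eq_sum: "abs_tensor ps = (\<Sum>(x, y)\<leftarrow>ps. x \<otimes> y)"
proof (induction ps)
  case Nil
  show ?case by (simp add: zero_tensor.abs_eq)
next
  case (Cons p ps)
  have "abs_tensor (p # ps) = abs_tensor [p] + abs_tensor ps"
    by (simp add: plus_tensor.abs_eq)
  then show ?case
    using Cons by (cases p) (simp add: tensor_of.abs_eq)
qed

definition tensor_space ::
    "'a::real_vector set \<Rightarrow> 'b::real_vector set \<Rightarrow> ('a, 'b) tensor set" where
  "tensor_space S T = span {x \<otimes> y |x y. x \<in> S \<and> y \<in> T}"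

definition tensor_map :: "('a::real_vector \<Rightarrow> 'c::real_vector) \<Rightarrow> ('b::real_vector \<Rightarrow> 'd::real_vector)
    \<Rightarrow> ('a, 'b) tensor \<Rightarrow> ('c, 'd) tensor" where
  "tensor_map f g = tensor_lift (\<lambda>x y. f x \<otimes> g y)"

lemma tensor_map_tensor_of:
  assumes "linear f" "linear g"
  shows "tensor_map f g (x \<otimes> y) = f x \<otimes> g y"
proof -
  have "bilinear (\<lambda>x y. f x \<otimes> g y)"
    by (intro bilinearI) (simp_all add: linear_add[OF assms(1)] linear_add[OF assms(2)]
        linear_scale[OF assms(1)] linear_scale[OF assms(2)] bilinear_ladd[OF bilinear_tensor_of]
        bilinear_radd[OF bilinear_tensor_of] bilinear_lmul[OF bilinear_tensor_of]
        bilinear_rmul[OF bilinear_tensor_of])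
  then show ?thesis by (simp add: tensor_map_def tensor_lift_tensor_of)
qed


section \<open>Injective and projective norms\<close>

text \<open>The spaces \<open>S\<close> and \<open>T\<close> are linear subspaces of ambient normed types, with the induced norms.
  This is what allows the dimension of \<open>\<ell>\<^sub>2\<^sup>n\<close> to vary inside a formula.\<close>

text \<open>Every linear functional on a subspace \<open>S\<close> is the restriction of a linear functional on the
  ambient space, so the members restricted to \<open>S\<close> are precisely the unit ball of the dual of \<open>S\<close>. Off
  \<open>S\<close> they are unconstrained, which does not affect their values on tensors over \<open>S\<close>.\<close>

definition dual_ball :: "'a::real_normed_vector set \<Rightarrow> ('a \<Rightarrow> real) set" where
  "dual_ball S = {f. linear f \<and> (\<forall>x\<in>S. \<bar>f x\<bar> \<le> norm x)}"

definition inj_norm :: "'a::real_normed_vector set \<Rightarrow> 'b::real_normed_vector set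
    \<Rightarrow> ('a, 'b) tensor \<Rightarrow> real" where
  "inj_norm S T t =
     (SUP (f, g) \<in> dual_ball S \<times> dual_ball T. \<bar>tensor_lift (\<lambda>x y. f x * g y) t\<bar>)"

definition proj_norm :: "'a::real_normed_vector set \<Rightarrow> 'b::real_normed_vector set
    \<Rightarrow> ('a, 'b) tensor \<Rightarrow> real" where
  "proj_norm S T t =
     Inf {(\<Sum>(x, y)\<leftarrow>ps. norm x * norm y) |ps. set ps \<subseteq> S \<times> T \<and> t = (\<Sum>(x, y)\<leftarrow>ps. x \<otimes> y)}"

lemma bilinear_functionals:
  fixes f :: "'a::real_vector \<Rightarrow> real" and g :: "'b::real_vector \<Rightarrow> real"
  assumes "linear f" "linear g"
  shows "bilinear (\<lambda>x y. f x * g y)"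
  unfolding bilinear_def
  by (auto intro!: linearI simp: linear_add[OF assms(1)] linear_add[OF assms(2)]
        linear_scale[OF assms(1)] linear_scale[OF assms(2)] algebra_simps)


section \<open>Positivity, the trace pairing, and tensors as operators\<close>

definition tensor_nonneg :: "('a::real_vector, 'a) tensor \<Rightarrow> bool" where
  "tensor_nonneg t \<longleftrightarrow> t \<in> convex hull (range (\<lambda>x. x \<otimes> x))"

definition tensor_pairing ::
    "('a::real_normed_vector, 'b::real_normed_vector) tensor \<Rightarrow>
     ('a \<Rightarrow>\<^sub>L real, 'b \<Rightarrow>\<^sub>L real) tensor \<Rightarrow> real" where
  "tensor_pairing A B =
     tensor_lift (\<lambda>f g. tensor_lift (\<lambda>x y. blinfun_apply f x * blinfun_apply g y) A) B"

lift_definition rank_one :: "'a::real_normed_vector \<Rightarrow>\<^sub>L real \<Rightarrow> 'b::real_normed_vector \<Rightarrow> 'a \<Rightarrow>\<^sub>L 'b"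
  is "\<lambda>f y x. f x *\<^sub>R y"
  by (rule bounded_linear_scaleR_const)

definition tensor_op ::
    "('a::real_normed_vector \<Rightarrow>\<^sub>L real, 'b::real_normed_vector) tensor \<Rightarrow> 'a \<Rightarrow>\<^sub>L 'b" where
  "tensor_op = tensor_lift rank_one"

lemma linear_blinfun_apply: "linear (blinfun_apply f)"
  by (simp add: blinfun.bounded_linear_right bounded_linear.linear)

lemma bilinear_rank_one: "bilinear rank_one"
  unfolding bilinear_def
  by (auto intro!: linearI blinfun_eqI
      simp: rank_one.rep_eq blinfun.add_left blinfun.scaleR_left algebra_simps)

lemma tensor_op_tensor_of: "blinfun_apply (tensor_op (f \<otimes> y)) x = blinfun_apply f x *\<^sub>R y"
  by (simp add: tensor_op_def tensor_lift_tensor_of bilinear_rank_one rank_one.rep_eq)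

lemma bilinear_tensor_lift_functionals:
  fixes A :: "('a::real_normed_vector, 'b::real_normed_vector) tensor"
  shows "bilinear (\<lambda>f g. tensor_lift (\<lambda>x y. blinfun_apply f x * (blinfun_apply g y :: real)) A)"
proof -
  define b :: "('a \<Rightarrow>\<^sub>L real) \<Rightarrow> ('b \<Rightarrow>\<^sub>L real) \<Rightarrow> 'a \<Rightarrow> 'b \<Rightarrow> real"
    where "b f g = (\<lambda>x y. blinfun_apply f x * blinfun_apply g y)" for f g
  have "bilinear (b f g)" for f g
    by (simp add: b_def bilinear_functionals linear_blinfun_apply)
  moreover obtain ps where "A = abs_tensor ps" by (metis Quotient_tensor Quotient_abs_rep)
  ultimately have eq: "tensor_lift (b f g) A = tensor_sum (b f g) ps" for f g
    by (simp add: tensor_lift.abs_eq)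
  have "tensor_sum (b (f + f') g) ps = tensor_sum (b f g) ps + tensor_sum (b f' g) ps"
    "tensor_sum (b f (g + g')) ps = tensor_sum (b f g) ps + tensor_sum (b f g') ps"
    "tensor_sum (b (r *\<^sub>R f) g) ps = r *\<^sub>R tensor_sum (b f g) ps"
    "tensor_sum (b f (r *\<^sub>R g)) ps = r *\<^sub>R tensor_sum (b f g) ps" for f f' g g' r
    by (induction ps) (auto simp: b_def blinfun.add_left blinfun.scaleR_left algebra_simps)
  then have "bilinear (\<lambda>f g. tensor_lift (b f g) A)"
    unfolding eq by (rule bilinearI)
  then show ?thesis unfolding b_def .
qed

lemma tensor_pairing_tensor_of:
  "tensor_pairing (x \<otimes> y) (f \<otimes> g) = blinfun_apply f x * blinfun_apply g y"
  unfolding tensor_pairing_def tensor_lift_tensor_of[OF bilinear_tensor_lift_functionals]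
  by (simp add: tensor_lift_tensor_of bilinear_functionals linear_blinfun_apply)


section \<open>The Hilbert space of square-summable sequences\<close>

typedef ell2 = "{x :: nat \<Rightarrow> real. summable (\<lambda>i. (x i)\<^sup>2)}"
  morphisms ell2_nth Abs_ell2
  by (rule exI[of _ "\<lambda>_. 0"]) simp

setup_lifting type_definition_ell2

lemma summable_mult_squares:
  fixes x y :: "nat \<Rightarrow> real"
  assumes "summable (\<lambda>i. (x i)\<^sup>2)" "summable (\<lambda>i. (y i)\<^sup>2)"
  shows "summable (\<lambda>i. x i * y i)"
proof (rule summable_comparison_test'[where N = 0])
  show "summable (\<lambda>i. (x i)\<^sup>2 + (y i)\<^sup>2)"
    using assms by (rule summable_add)
  show "norm (x i * y i) \<le> (x i)\<^sup>2 + (y i)\<^sup>2" for i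
  proof -
    have "2 * (\<bar>x i\<bar> * \<bar>y i\<bar>) \<le> (x i)\<^sup>2 + (y i)\<^sup>2"
      using sum_squares_bound[of "\<bar>x i\<bar>" "\<bar>y i\<bar>"] by (simp add: mult.assoc)
    moreover have "0 \<le> \<bar>x i\<bar> * \<bar>y i\<bar>" by simp
    ultimately have "\<bar>x i\<bar> * \<bar>y i\<bar> \<le> (x i)\<^sup>2 + (y i)\<^sup>2" by linarith
    then show ?thesis by (simp add: abs_mult)
  qed
qed

instantiation ell2 :: real_inner
begin

lift_definition zero_ell2 :: ell2 is "\<lambda>_. 0" by simp

lift_definition plus_ell2 :: "ell2 \<Rightarrow> ell2 \<Rightarrow> ell2" is "\<lambda>x y i. x i + y i"
proof -
  fix x y :: "nat \<Rightarrow> real"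
  assume *: "summable (\<lambda>i. (x i)\<^sup>2)" "summable (\<lambda>i. (y i)\<^sup>2)"
  have "summable (\<lambda>i. (x i)\<^sup>2 + (y i)\<^sup>2 + 2 * (x i * y i))"
    using * by (intro summable_add summable_mult summable_mult_squares)
  then show "summable (\<lambda>i. (x i + y i)\<^sup>2)"
    by (simp add: power2_sum mult.assoc)
qed

lift_definition uminus_ell2 :: "ell2 \<Rightarrow> ell2" is "\<lambda>x i. - x i" by simp

definition minus_ell2 :: "ell2 \<Rightarrow> ell2 \<Rightarrow> ell2" where "minus_ell2 x y = x + - y"

lift_definition scaleR_ell2 :: "real \<Rightarrow> ell2 \<Rightarrow> ell2" is "\<lambda>r x i. r * x i"
  by (simp add: power_mult_distrib summable_mult)

lift_definition inner_ell2 :: "ell2 \<Rightarrow> ell2 \<Rightarrow> real" is "\<lambda>x y. \<Sum>i. x i * y i" .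

definition norm_ell2 :: "ell2 \<Rightarrow> real" where "norm_ell2 x = sqrt (inner x x)"

definition sgn_ell2 :: "ell2 \<Rightarrow> ell2" where "sgn_ell2 x = inverse (norm x) *\<^sub>R x"

definition dist_ell2 :: "ell2 \<Rightarrow> ell2 \<Rightarrow> real" where "dist_ell2 x y = norm (x - y)"

definition uniformity_ell2 :: "(ell2 \<times> ell2) filter" where
  "uniformity_ell2 = (INF e\<in>{0<..}. principal {(x, y). dist x y < e})"

definition open_ell2 :: "ell2 set \<Rightarrow> bool" where
  "open_ell2 U \<longleftrightarrow> (\<forall>x\<in>U. \<forall>\<^sub>F (x', y) in uniformity. x' = x \<longrightarrow> y \<in> U)"

instance
proof
  fix x y z :: ell2 and r s :: real and U :: "ell2 set"
  show "x + y + z = x + (y + z)" by transfer (simp add: add.assoc)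
  show "x + y = y + x" by transfer (simp add: add.commute)
  show "0 + x = x" by transfer simp
  show "- x + x = 0" by transfer simp
  show "x - y = x + - y" by (simp add: minus_ell2_def)
  show "r *\<^sub>R (x + y) = r *\<^sub>R x + r *\<^sub>R y" by transfer (simp add: algebra_simps)
  show "(r + s) *\<^sub>R x = r *\<^sub>R x + s *\<^sub>R x" by transfer (simp add: algebra_simps)
  show "r *\<^sub>R s *\<^sub>R x = (r * s) *\<^sub>R x" by transfer (simp add: algebra_simps)
  show "1 *\<^sub>R x = x" by transfer simp
  show "sgn x = inverse (norm x) *\<^sub>R x" by (rule sgn_ell2_def)
  show "dist x y = norm (x - y)" by (rule dist_ell2_def)
  show "uniformity = (INF e\<in>{0<..}. principal {(x :: ell2, y). dist x y < e})"
    by (rule uniformity_ell2_def)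
  show "open U \<longleftrightarrow> (\<forall>x\<in>U. \<forall>\<^sub>F (x', y) in uniformity. x' = x \<longrightarrow> y \<in> U)"
    by (rule open_ell2_def)
  show "inner x y = inner y x" by transfer (simp add: mult.commute)
  show "inner (x + y) z = inner x z + inner y z"
    by transfer (simp add: algebra_simps suminf_add summable_mult_squares)
  show "inner (r *\<^sub>R x) y = r * inner x y"
    by transfer (simp add: mult.assoc suminf_mult summable_mult_squares)
  show "0 \<le> inner x x"
    by transfer (auto intro!: suminf_nonneg simp: power2_eq_square)
  show "inner x x = 0 \<longleftrightarrow> x = 0"
  proof transfer
    fix x :: "nat \<Rightarrow> real"
    assume "summable (\<lambda>i. (x i)\<^sup>2)"
    then show "((\<Sum>i. x i * x i) = 0) = (x = (\<lambda>_. 0))"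
      using suminf_eq_zero_iff[of "\<lambda>i. (x i)\<^sup>2"] by (auto simp: power2_eq_square fun_eq_iff)
  qed
  show "norm x = sqrt (inner x x)" by (rule norm_ell2_def)
qed

end

text \<open>\<open>\<ell>\<^sub>2\<^sup>n\<close>, realised isometrically as the sequences vanishing from index \<open>n\<close> on.\<close>

definition ell2n :: "nat \<Rightarrow> ell2 set" where
  "ell2n n = {x. \<forall>i\<ge>n. ell2_nth x i = 0}"

lemma norm_ell2n:
  assumes "x \<in> ell2n n"
  shows "norm x = L2_set (ell2_nth x) {..<n}"
proof -
  have "(\<Sum>i. ell2_nth x i * ell2_nth x i) = (\<Sum>i<n. ell2_nth x i * ell2_nth x i)"
    using assms by (intro suminf_finite) (auto simp: ell2n_def not_less)
  then show ?thesis
    by (simp add: norm_ell2_def inner_ell2.rep_eq L2_set_def power2_eq_square)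
qed


section \<open>The quantities compared\<close>

text \<open>All suprema and infima below are taken in \<open>[0, \<infinity>]\<close>, so that no finiteness is presupposed;
  in particular the constants \<open>c\<close> and \<open>C\<close> range over nonnegative reals.\<close>

definition gamma_const :: "'a::real_normed_vector itself \<Rightarrow> ennreal" where
  "gamma_const _ = Inf (ennreal ` {c. 0 \<le> c \<and>
     (\<forall>(A :: ('a, 'a) tensor) (B :: ('a \<Rightarrow>\<^sub>L real, 'a \<Rightarrow>\<^sub>L real) tensor).
        tensor_nonneg A \<longrightarrow> tensor_nonneg B \<longrightarrow>
        tensor_pairing A B \<le> c * inj_norm UNIV UNIV A * inj_norm UNIV UNIV B)})"

definition op_nonneg :: "('a::real_normed_vector \<Rightarrow>\<^sub>L ('a \<Rightarrow>\<^sub>L real)) \<Rightarrow> bool" where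
  "op_nonneg A \<longleftrightarrow> (\<exists>B. tensor_nonneg B \<and> tensor_op B = A)"

definition inj_proj_norm ::
    "('a::real_normed_vector \<Rightarrow>\<^sub>L 'b::real_normed_vector) \<Rightarrow> 'f::real_normed_vector set \<Rightarrow> ennreal" where
  "inj_proj_norm A F =
     (SUP u \<in> {u \<in> tensor_space UNIV F. inj_norm UNIV F u \<le> 1}.
        ennreal (proj_norm UNIV F (tensor_map (blinfun_apply A) id u)))"

definition KG_plus :: "'a::real_normed_vector itself \<Rightarrow> 'f::real_normed_vector set \<Rightarrow> ennreal" where
  "KG_plus _ F =
     (SUP A \<in> {A :: 'a \<Rightarrow>\<^sub>L ('a \<Rightarrow>\<^sub>L real). op_nonneg A \<and> norm A \<le> 1}. inj_proj_norm A F)"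

definition pi2_norm :: "('a::real_normed_vector \<Rightarrow>\<^sub>L 'b::real_normed_vector) \<Rightarrow> ennreal" where
  "pi2_norm u = Inf (ennreal ` {C. 0 \<le> C \<and>
     (\<forall>xs :: 'a list. sqrt (\<Sum>x\<leftarrow>xs. (norm (blinfun_apply u x))\<^sup>2)
        \<le> C * (SUP f \<in> {f :: 'a \<Rightarrow>\<^sub>L real. norm f \<le> 1}. sqrt (\<Sum>x\<leftarrow>xs. \<bar>blinfun_apply f x\<bar>\<^sup>2)))})"

definition id_norm_B_Pi2 :: "'a::real_normed_vector itself \<Rightarrow> ennreal" where
  "id_norm_B_Pi2 _ = (SUP u \<in> {u :: 'a \<Rightarrow>\<^sub>L ell2. norm u \<le> 1}. pi2_norm u)"

end

theory Submission
  imports Defs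
begin

text \<open>
  Positive tensors are sums of squares, and on sums of squares everything becomes a statement about
  finite families of vectors and functionals. For \<open>A = \<Sum>\<^sub>i x\<^sub>i \<otimes> x\<^sub>i\<close> and \<open>B = \<Sum>\<^sub>j f\<^sub>j \<otimes> f\<^sub>j\<close>, Cauchy-Schwarz
  shows that the injective norm of \<open>A\<close> is the supremum of \<open>\<Sum>\<^sub>i f(x\<^sub>i)\<^sup>2\<close> over the dual unit ball, and that the
  injective norm of \<open>B\<close> is the least \<open>K\<close> with \<open>\<Sum>\<^sub>j f\<^sub>j(v)\<^sup>2 \<le> K \<parallel>v\<parallel>\<^sup>2\<close>; the pairing of \<open>A\<close> and \<open>B\<close> is
  \<open>\<Sum>\<^sub>i \<Sum>\<^sub>j f\<^sub>j(x\<^sub>i)\<^sup>2\<close>. So the first constant is the supremum of this double sum when both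
  families are normalised (\<open>positive_pairing_boundD\<close>, \<open>positive_pairing_boundI\<close>).

  Reading the \<open>f\<^sub>j\<close> as the coordinates of an operator \<open>u\<close> into \<open>\<ell>\<^sub>2\<close>, the double sum is
  \<open>\<Sum>\<^sub>i \<parallel>u x\<^sub>i\<parallel>\<^sup>2\<close>, and its supremum is the square of the supremum of the 2-summing norms of contractions.
  An operator with infinitely many nonzero coordinates is reached by truncation
  (\<open>gamma_const_eq_id_norm_squared\<close>).

  For the Grothendieck constants, let \<open>T = \<Sum>\<^sub>j f\<^sub>j \<otimes> f\<^sub>j\<close> be a positive operator of norm at most 1 and
  \<open>u = \<Sum>\<^sub>k x\<^sub>k \<otimes> e\<^sub>k\<close> a tensor over \<open>\<ell>\<^sub>2\<^sup>n\<close> of injective norm at most 1, which says that \<open>(x\<^sub>k)\<close> is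
  normalised. By Hahn-Banach and finite dimensionality, the projective norm of
  \<open>(T \<otimes> id) u = \<Sum>\<^sub>k T x\<^sub>k \<otimes> e\<^sub>k\<close> equals \<open>\<Sum>\<^sub>k (T x\<^sub>k)(y\<^sub>k) = \<Sum>\<^sub>k \<Sum>\<^sub>j f\<^sub>j(x\<^sub>k) f\<^sub>j(y\<^sub>k)\<close> for another
  normalised family \<open>(y\<^sub>k)\<close>; this is at most the mean of two double sums of the kind above
  (\<open>KG_plus_le_gamma_const\<close>). Conversely, testing \<open>(T \<otimes> id) u\<close> against the family \<open>(x\<^sub>k)\<close> itself gives
  exactly \<open>\<Sum>\<^sub>k \<Sum>\<^sub>j f\<^sub>j(x\<^sub>k)\<^sup>2\<close>, so the constant over \<open>\<ell>\<^sub>2\<^sup>n\<close> dominates all double sums with at most \<open>n\<close>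
  vectors. Completing squares rewrites any positive tensor with \<open>dim E\<close> squares, so every
  \<open>n \<ge> dim E\<close> suffices (\<open>gamma_const_le_KG_plus\<close>).
\<close>

section \<open>Tensors as finite sums\<close>

lemma linear_tensor_of: "linear (\<lambda>x. x \<otimes> y)" "linear (\<lambda>y. x \<otimes> y)"
  using bilinear_tensor_of by (auto simp: bilinear_def)

lemma tensor_lift_sum:
  assumes "bilinear f"
  shows "tensor_lift f (\<Sum>i\<in>I. x i \<otimes> y i) = (\<Sum>i\<in>I. f (x i) (y i))"
  by (simp add: linear_sum[OF linear_tensor_lift] tensor_lift_tensor_of assms)

lemma tensor_lift_sum_list:
  assumes "bilinear f"
  shows "tensor_lift f (\<Sum>(x, y)\<leftarrow>ps. x \<otimes> y) = (\<Sum>(x, y)\<leftarrow>ps. f x y)"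
  by (induction ps)
    (auto simp: linear_0[OF linear_tensor_lift] linear_add[OF linear_tensor_lift]
      tensor_lift_tensor_of assms)

lemma tensor_map_sum:
  assumes "linear f" "linear g"
  shows "tensor_map f g (\<Sum>i\<in>I. x i \<otimes> y i) = (\<Sum>i\<in>I. f (x i) \<otimes> g (y i))"
proof -
  have "linear (tensor_map f g)" unfolding tensor_map_def by (rule linear_tensor_lift)
  then show ?thesis by (simp add: linear_sum tensor_map_tensor_of assms)
qed

lemma tensor_pairing_sum_squares:
  "tensor_pairing (\<Sum>i\<in>I. x i \<otimes> x i) (\<Sum>j\<in>J. f j \<otimes> f j)
    = (\<Sum>i\<in>I. \<Sum>j\<in>J. (blinfun_apply (f j) (x i))\<^sup>2)"
  unfolding tensor_pairing_def tensor_lift_sum[OF bilinear_tensor_lift_functionals]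
  by (subst sum.swap)
    (simp add: tensor_lift_sum bilinear_functionals linear_blinfun_apply power2_eq_square)

lemma tensor_op_sum_squares:
  "blinfun_apply (blinfun_apply (tensor_op (\<Sum>j\<in>J. f j \<otimes> f j)) x) y
    = (\<Sum>j\<in>J. blinfun_apply (f j) x * blinfun_apply (f j) y)"
  by (simp add: tensor_op_def tensor_lift_sum bilinear_rank_one blinfun.sum_left
      blinfun.scaleR_left rank_one.rep_eq)

lemma tensor_space_representation:
  assumes "subspace S" "t \<in> tensor_space S T"
  shows "\<exists>ps. set ps \<subseteq> S \<times> T \<and> t = (\<Sum>(x, y)\<leftarrow>ps. x \<otimes> y)"
  using assms(2) unfolding tensor_space_def
proof (induction rule: span_induct_alt)
  case base
  show ?case by (rule exI[of _ "[]"]) simp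
next
  case (step c p t)
  then obtain x y ps where "p = x \<otimes> y" "x \<in> S" "y \<in> T" "set ps \<subseteq> S \<times> T"
    "t = (\<Sum>(x, y)\<leftarrow>ps. x \<otimes> y)" by auto
  then show ?case
    by (intro exI[of _ "(c *\<^sub>R x, y) # ps"])
      (auto simp: bilinear_lmul[OF bilinear_tensor_of] subspace_scale[OF assms(1)])
qed

lemma tensor_space_UNIV: "tensor_space UNIV UNIV = UNIV"
proof -
  have "t \<in> tensor_space UNIV UNIV" for t :: "('a, 'b) tensor"
  proof -
    obtain ps where "t = abs_tensor ps" by (metis Quotient_tensor Quotient_abs_rep)
    moreover have "(\<Sum>(x, y)\<leftarrow>ps. x \<otimes> y) \<in> tensor_space UNIV UNIV"
      unfolding tensor_space_def
    proof (induction ps)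
      case (Cons p ps)
      obtain x y where p: "p = (x, y)" by force
      have "x \<otimes> y \<in> span {x \<otimes> y |x y. x \<in> UNIV \<and> y \<in> UNIV}" by (rule span_base) blast
      with Cons show ?case by (simp add: p span_add)
    qed (simp add: span_zero)
    ultimately show ?thesis by (simp add: Abs_tensor_eq_sum)
  qed
  then show ?thesis by auto
qed

text \<open>Nonnegative scalars are absorbed into the squares, so the sums of squares form a convex cone. That
  cone is contained in the convex hull because the hull is closed under doubling, and a sum is the
  midpoint of two doubles.\<close>

lemma tensor_nonneg_iff_sum_squares:
  "tensor_nonneg t \<longleftrightarrow> (\<exists>(m::nat) x. t = (\<Sum>i<m. x i \<otimes> x i))"
proof
  let ?S = "{t. \<exists>(m::nat) x. t = (\<Sum>i<m. x i \<otimes> x i)} :: ('a, 'a) tensor set"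
  have scale: "c *\<^sub>R (x \<otimes> x) = (sqrt c *\<^sub>R x) \<otimes> (sqrt c *\<^sub>R x)" if "0 \<le> c" for c and x :: 'a
    using that
    by (simp add: bilinear_lmul[OF bilinear_tensor_of] bilinear_rmul[OF bilinear_tensor_of])
  have scale_mem: "c *\<^sub>R s \<in> ?S" if "0 \<le> c" "s \<in> ?S" for c s
  proof -
    from that(2) obtain m :: nat and x where "s = (\<Sum>i<m. x i \<otimes> x i)" by blast
    then have "c *\<^sub>R s = (\<Sum>i<m. (sqrt c *\<^sub>R x i) \<otimes> (sqrt c *\<^sub>R x i))"
      using that(1) by (simp add: scaleR_sum_right scale)
    then show ?thesis by (auto intro!: exI[of _ m] exI[of _ "\<lambda>i. sqrt c *\<^sub>R x i"])
  qed
  have add_mem: "s + s' \<in> ?S" if s: "s \<in> ?S" "s' \<in> ?S" for s s'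
  proof -
    from s obtain m n :: nat and x y where
      xy: "s = (\<Sum>i<m. x i \<otimes> x i)" "s' = (\<Sum>i<n. y i \<otimes> y i)" by blast
    define z where "z i = (if i < m then x i else y (i - m))" for i
    have "(\<Sum>i<m + n. z i \<otimes> z i) = (\<Sum>i<m. z i \<otimes> z i) + (\<Sum>i<n. z (m + i) \<otimes> z (m + i))"
      by (induction n) (auto simp: add.assoc)
    then have "s + s' = (\<Sum>i<m + n. z i \<otimes> z i)" by (simp add: xy z_def)
    then show ?thesis by blast
  qed
  show "\<exists>(m::nat) x. t = (\<Sum>i<m. x i \<otimes> x i)" if "tensor_nonneg t"
  proof -
    have "convex ?S"
      by (intro convexI add_mem scale_mem)
    moreover have "range (\<lambda>x. x \<otimes> x) \<subseteq> ?S"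
    proof
      fix s :: "('a, 'a) tensor" assume "s \<in> range (\<lambda>x. x \<otimes> x)"
      then obtain x where "s = x \<otimes> x" by blast
      then have "s = (\<Sum>i<Suc 0. x \<otimes> x)" by simp
      then show "s \<in> ?S" by (auto intro!: exI[of _ "Suc 0"] exI[of _ "\<lambda>_. x"])
    qed
    ultimately have "convex hull (range (\<lambda>x. x \<otimes> x)) \<subseteq> ?S" by (rule hull_minimal[rotated])
    with that show ?thesis by (auto simp: tensor_nonneg_def)
  qed
  assume "\<exists>(m::nat) x. t = (\<Sum>i<m. x i \<otimes> x i)"
  then obtain m :: nat and x where t: "t = (\<Sum>i<m. x i \<otimes> x i)" by blast
  let ?C = "convex hull (range (\<lambda>x. x \<otimes> x)) :: ('a, 'a) tensor set"
  have "(\<Sum>i<m. x i \<otimes> x i) \<in> ?C"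
  proof (induction m)
    case 0
    have "0 \<otimes> 0 \<in> ?C" by (rule hull_inc) blast
    then show ?case by (simp add: bilinear_lzero[OF bilinear_tensor_of])
  next
    case (Suc m)
    have "(\<lambda>s. 2 *\<^sub>R s) ` range (\<lambda>x::'a. x \<otimes> x) \<subseteq> range (\<lambda>x. x \<otimes> x)"
      by (auto simp: scale)
    then have double: "2 *\<^sub>R s \<in> ?C" if "s \<in> ?C" for s
      using that hull_mono[of "(\<lambda>s. 2 *\<^sub>R s) ` range (\<lambda>x::'a. x \<otimes> x)" "range (\<lambda>x. x \<otimes> x)" convex]
      unfolding convex_hull_scaling by blast
    have "x m \<otimes> x m \<in> ?C" by (rule hull_inc) blast
    with Suc double have "(1/2) *\<^sub>R (2 *\<^sub>R (\<Sum>i<m. x i \<otimes> x i)) + (1/2) *\<^sub>R (2 *\<^sub>R (x m \<otimes> x m)) \<in> ?C"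
      by (intro convexD convex_convex_hull) auto
    then show ?case by simp
  qed
  with t show "tensor_nonneg t" by (simp add: tensor_nonneg_def)
qed

section \<open>The injective norm of a sum of squares\<close>

lemma zero_in_dual_ball: "(\<lambda>_. 0) \<in> dual_ball S"
  by (simp add: dual_ball_def linear_zero)

lemma inj_norm_le:
  assumes "\<And>f g. f \<in> dual_ball S \<Longrightarrow> g \<in> dual_ball T \<Longrightarrow> \<bar>tensor_lift (\<lambda>x y. f x * g y) t\<bar> \<le> K"
  shows "inj_norm S T t \<le> K"
  unfolding inj_norm_def using assms zero_in_dual_ball[of S] zero_in_dual_ball[of T]
  by (intro cSUP_least) auto

text \<open>The defining supremum is bounded because any representation of the tensor bounds its values; only
  then is it an upper bound in the conditionally complete order of the reals.\<close>

lemma inj_norm_ge: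
  assumes S: "subspace S" and t: "t \<in> tensor_space S T" and f: "f \<in> dual_ball S" and g: "g \<in> dual_ball T"
  shows "\<bar>tensor_lift (\<lambda>x y. f x * g y) t\<bar> \<le> inj_norm S T t"
proof -
  obtain ps where ps: "set ps \<subseteq> S \<times> T" "t = (\<Sum>(x, y)\<leftarrow>ps. x \<otimes> y)"
    using tensor_space_representation[OF S t] by blast
  have "\<bar>tensor_lift (\<lambda>x y. f x * g y) t\<bar> \<le> (\<Sum>(x, y)\<leftarrow>ps. norm x * norm y)"
    if "f \<in> dual_ball S" "g \<in> dual_ball T" for f g
  proof -
    have "bilinear (\<lambda>x y. f x * g y)"
      using that by (simp add: bilinear_functionals dual_ball_def)
    then have "tensor_lift (\<lambda>x y. f x * g y) t = (\<Sum>(x, y)\<leftarrow>ps. f x * g y)"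
      by (simp add: ps(2) tensor_lift_sum_list)
    moreover have "\<bar>\<Sum>(x, y)\<leftarrow>ps. f x * g y\<bar> \<le> (\<Sum>(x, y)\<leftarrow>ps. norm x * norm y)"
      using ps(1)
    proof (induction ps)
      case (Cons p ps)
      obtain x y where p: "p = (x, y)" by force
      have "\<bar>f x * g y\<bar> \<le> norm x * norm y"
        unfolding abs_mult using that Cons.prems p
        by (intro mult_mono) (auto simp: dual_ball_def)
      with Cons p show ?case by auto
    qed simp
    ultimately show ?thesis by simp
  qed
  then have "bdd_above ((\<lambda>(f, g). \<bar>tensor_lift (\<lambda>x y. f x * g y) t\<bar>) ` (dual_ball S \<times> dual_ball T))"
    by (intro bdd_aboveI[of _ "\<Sum>(x, y)\<leftarrow>ps. norm x * norm y"]) auto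
  from cSUP_upper[OF _ this, of "(f, g)"] show ?thesis
    using f g by (simp add: inj_norm_def)
qed

lemma dual_ball_UNIV: "f \<in> dual_ball UNIV \<longleftrightarrow> (\<exists>F. norm F \<le> 1 \<and> f = blinfun_apply F)"
proof
  assume f: "f \<in> dual_ball UNIV"
  then have "bounded_linear f"
    by (intro bounded_linear_intro[where K = 1])
      (auto simp: dual_ball_def linear_add linear_scale)
  then have "f = blinfun_apply (Blinfun f)" by (simp add: bounded_linear_Blinfun_apply)
  moreover from this have "norm (Blinfun f) \<le> 1"
    using f by (intro norm_blinfun_bound) (auto simp: dual_ball_def)
  ultimately show "\<exists>F. norm F \<le> 1 \<and> f = blinfun_apply F" by blast
next
  assume "\<exists>F. norm F \<le> 1 \<and> f = blinfun_apply F"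
  then obtain F where F: "norm F \<le> 1" "f = blinfun_apply F" by blast
  have "\<bar>blinfun_apply F x\<bar> \<le> norm x" for x
    using norm_blinfun[of F x] mult_right_mono[OF F(1), of "norm x"] by simp
  then show "f \<in> dual_ball UNIV"
    by (simp add: F(2) dual_ball_def linear_blinfun_apply)
qed

text \<open>The arithmetic-geometric mean inequality takes the place of Cauchy-Schwarz whenever both families
  are normalised to the same constant.\<close>

lemma sum_mult_le_sum_squares:
  fixes a b :: "'i \<Rightarrow> real"
  assumes "(\<Sum>i\<in>I. (a i)\<^sup>2) \<le> K" "(\<Sum>i\<in>I. (b i)\<^sup>2) \<le> K"
  shows "\<bar>\<Sum>i\<in>I. a i * b i\<bar> \<le> K"
proof -
  have "\<bar>a i * b i\<bar> \<le> ((a i)\<^sup>2 + (b i)\<^sup>2) / 2" for i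
    using sum_squares_bound[of "\<bar>a i\<bar>" "\<bar>b i\<bar>"] by (simp add: abs_mult)
  then have "\<bar>\<Sum>i\<in>I. a i * b i\<bar> \<le> (\<Sum>i\<in>I. ((a i)\<^sup>2 + (b i)\<^sup>2) / 2)"
    by (intro order_trans[OF sum_abs] sum_mono)
  also have "\<dots> = ((\<Sum>i\<in>I. (a i)\<^sup>2) + (\<Sum>i\<in>I. (b i)\<^sup>2)) / 2"
    by (simp add: sum.distrib flip: sum_divide_distrib)
  finally show ?thesis using assms by simp
qed

lemma inj_norm_sum_squares_le:
  assumes "\<And>f. f \<in> dual_ball UNIV \<Longrightarrow> (\<Sum>i\<in>I. (f (x i))\<^sup>2) \<le> K"
  shows "inj_norm UNIV UNIV (\<Sum>i\<in>I. x i \<otimes> x i) \<le> K"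
proof (rule inj_norm_le)
  fix f g :: "'a \<Rightarrow> real" assume fg: "f \<in> dual_ball UNIV" "g \<in> dual_ball UNIV"
  then have "bilinear (\<lambda>x y. f x * g y)" by (simp add: bilinear_functionals dual_ball_def)
  then show "\<bar>tensor_lift (\<lambda>x y. f x * g y) (\<Sum>i\<in>I. x i \<otimes> x i)\<bar> \<le> K"
    using assms fg by (simp add: tensor_lift_sum sum_mult_le_sum_squares)
qed

lemma inj_norm_sum_squares_ge:
  assumes "f \<in> dual_ball UNIV"
  shows "(\<Sum>i\<in>I. (f (x i))\<^sup>2) \<le> inj_norm UNIV UNIV (\<Sum>i\<in>I. x i \<otimes> x i)"
proof -
  have "bilinear (\<lambda>x y. f x * f y)" using assms by (simp add: bilinear_functionals dual_ball_def)
  then have "tensor_lift (\<lambda>x y. f x * f y) (\<Sum>i\<in>I. x i \<otimes> x i) = (\<Sum>i\<in>I. (f (x i))\<^sup>2)"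
    by (simp add: tensor_lift_sum power2_eq_square)
  with inj_norm_ge[of UNIV "\<Sum>i\<in>I. x i \<otimes> x i" UNIV f f] assms show ?thesis
    by (simp add: tensor_space_UNIV)
qed

lemma inj_norm_nonneg:
  assumes "subspace S" "t \<in> tensor_space S T"
  shows "0 \<le> inj_norm S T t"
  using order_trans[OF abs_ge_zero inj_norm_ge[OF assms zero_in_dual_ball zero_in_dual_ball]] .

text \<open>The dual ball of the dual space may contain functionals that are not evaluations at vectors. A
  functional \<open>\<phi>\<close> of norm at most 1 satisfies
  \<open>\<Sum>\<^sub>j \<phi>(f\<^sub>j)\<^sup>2 = \<phi>(\<Sum>\<^sub>j \<phi>(f\<^sub>j) f\<^sub>j) \<le> \<parallel>\<Sum>\<^sub>j \<phi>(f\<^sub>j) f\<^sub>j\<parallel>\<close>, and the last norm is computed on vectors. With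
  \<open>s\<close> the left side, Cauchy-Schwarz bounds it by the square root of \<open>s K\<close>, whence \<open>s \<le> K\<close>.\<close>

lemma inj_norm_functional_squares_le:
  fixes f :: "'i \<Rightarrow> 'a::real_normed_vector \<Rightarrow>\<^sub>L real"
  assumes "0 \<le> K" and bound: "\<And>x. (\<Sum>j\<in>J. (blinfun_apply (f j) x)\<^sup>2) \<le> K * (norm x)\<^sup>2"
  shows "inj_norm UNIV UNIV (\<Sum>j\<in>J. f j \<otimes> f j) \<le> K"
proof (rule inj_norm_sum_squares_le)
  fix \<phi> :: "('a \<Rightarrow>\<^sub>L real) \<Rightarrow> real" assume "\<phi> \<in> dual_ball UNIV"
  then have lin: "linear \<phi>" and le: "\<And>g. \<bar>\<phi> g\<bar> \<le> norm g" by (auto simp: dual_ball_def)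
  define s where "s = (\<Sum>j\<in>J. (\<phi> (f j))\<^sup>2)"
  have s0: "0 \<le> s" by (simp add: s_def sum_nonneg)
  define g where "g = (\<Sum>j\<in>J. \<phi> (f j) *\<^sub>R f j)"
  have "norm g \<le> sqrt (s * K)"
  proof (rule norm_blinfun_bound)
    fix x
    have "(blinfun_apply g x)\<^sup>2 = (\<Sum>j\<in>J. \<phi> (f j) * blinfun_apply (f j) x)\<^sup>2"
      by (simp add: g_def blinfun.sum_left blinfun.scaleR_left)
    also have "\<dots> \<le> s * (\<Sum>j\<in>J. (blinfun_apply (f j) x)\<^sup>2)"
      unfolding s_def by (rule Cauchy_Schwarz_ineq_sum)
    also have "\<dots> \<le> s * (K * (norm x)\<^sup>2)" by (intro mult_left_mono bound s0)
    finally have "\<bar>blinfun_apply g x\<bar> \<le> sqrt (s * (K * (norm x)\<^sup>2))"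
      using real_le_rsqrt by fastforce
    then show "norm (blinfun_apply g x) \<le> sqrt (s * K) * norm x"
      by (simp add: real_sqrt_mult)
  qed (simp add: s0 assms(1))
  moreover have "s = \<phi> g"
    by (simp add: s_def g_def linear_sum[OF lin] linear_scale[OF lin] power2_eq_square)
  ultimately have "s \<le> sqrt (s * K)" using le[of g] by linarith
  then have "s\<^sup>2 \<le> s * K" using s0 assms(1) real_sqrt_le_iff
    by (metis mult_nonneg_nonneg power_mono real_sqrt_pow2)
  then have "s * s \<le> s * K" by (simp add: power2_eq_square)
  then show "(\<Sum>j\<in>J. (\<phi> (f j))\<^sup>2) \<le> K"
    using s0 assms(1) unfolding s_def[symmetric] by (cases "s = 0") auto
qed

text \<open>Evaluation at a normalised vector is a functional of norm at most 1 on the dual space.\<close>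

lemma inj_norm_functional_squares_ge:
  fixes f :: "'i \<Rightarrow> 'a::real_normed_vector \<Rightarrow>\<^sub>L real"
  shows "(\<Sum>j\<in>J. (blinfun_apply (f j) x)\<^sup>2)
    \<le> inj_norm UNIV UNIV (\<Sum>j\<in>J. f j \<otimes> f j) * (norm x)\<^sup>2"
proof (cases "x = 0")
  case False
  define \<phi> :: "('a \<Rightarrow>\<^sub>L real) \<Rightarrow> real" where "\<phi> g = blinfun_apply g x / norm x" for g
  have "\<bar>\<phi> g\<bar> \<le> norm g" for g
    using False norm_blinfun[of g x] by (simp add: \<phi>_def divide_le_eq)
  then have "\<phi> \<in> dual_ball UNIV"
    by (auto simp: dual_ball_def \<phi>_def blinfun.add_left blinfun.scaleR_left add_divide_distrib
        intro!: linearI)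
  then have "(\<Sum>j\<in>J. (\<phi> (f j))\<^sup>2) \<le> inj_norm UNIV UNIV (\<Sum>j\<in>J. f j \<otimes> f j)"
    by (rule inj_norm_sum_squares_ge)
  then show ?thesis
    using False by (simp add: \<phi>_def power_divide divide_le_eq flip: sum_divide_distrib)
qed simp

section \<open>Finitely supported sequences\<close>

text \<open>Cutting off at \<open>n\<close> makes every coefficient function square-summable.\<close>

lift_definition ell2_of :: "nat \<Rightarrow> (nat \<Rightarrow> real) \<Rightarrow> ell2" is "\<lambda>n a i. if i < n then a i else 0"
  by (rule summable_finite[of "{..<n}" for n]) auto

definition ell2_unit :: "nat \<Rightarrow> ell2" where
  "ell2_unit k = ell2_of (Suc k) (\<lambda>i. of_bool (i = k))"

lemma ell2_nth_sum: "ell2_nth (\<Sum>i\<in>I. x i) k = (\<Sum>i\<in>I. ell2_nth (x i) k)"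
  by (induction I rule: infinite_finite_induct) (auto simp: zero_ell2.rep_eq plus_ell2.rep_eq)

lemma ell2_unit_nth: "ell2_nth (ell2_unit k) i = of_bool (i = k)"
  by (simp add: ell2_unit_def ell2_of.rep_eq)

lemma ell2_of_eq_sum: "ell2_of n a = (\<Sum>k<n. a k *\<^sub>R ell2_unit k)"
  by (rule ell2_nth_inject[THEN iffD1])
    (auto simp: fun_eq_iff ell2_nth_sum scaleR_ell2.rep_eq ell2_unit_nth ell2_of.rep_eq)

lemma ell2_of_add: "ell2_of n (\<lambda>j. a j + b j) = ell2_of n a + ell2_of n b"
  by transfer auto

lemma ell2_of_scaleR: "ell2_of n (\<lambda>j. r * a j) = r *\<^sub>R ell2_of n a"
  by transfer auto

lemma inner_ell2_of: "inner (ell2_of n a) z = (\<Sum>i<n. a i * ell2_nth z i)"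
proof -
  have "(\<Sum>i. ell2_nth (ell2_of n a) i * ell2_nth z i) = (\<Sum>i<n. ell2_nth (ell2_of n a) i * ell2_nth z i)"
    by (intro suminf_finite) (auto simp: ell2_of.rep_eq)
  then show ?thesis by (simp add: inner_ell2.rep_eq ell2_of.rep_eq)
qed

lemma norm_ell2_of: "(norm (ell2_of n a))\<^sup>2 = (\<Sum>i<n. (a i)\<^sup>2)"
  unfolding power2_norm_eq_inner inner_ell2_of by (simp add: ell2_of.rep_eq power2_eq_square)

lemma norm_ell2_sums: "(\<lambda>k. (ell2_nth z k)\<^sup>2) sums (norm z)\<^sup>2"
  using summable_sums[of "\<lambda>k. (ell2_nth z k)\<^sup>2"] ell2_nth[of z]
  unfolding power2_norm_eq_inner inner_ell2.rep_eq by (simp add: power2_eq_square)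

lemma ell2n_eq_sum:
  assumes "z \<in> ell2n n"
  shows "z = (\<Sum>k<n. ell2_nth z k *\<^sub>R ell2_unit k)"
  unfolding ell2_of_eq_sum[symmetric] using assms
  by (intro ell2_nth_inject[THEN iffD1]) (auto simp: fun_eq_iff ell2_of.rep_eq ell2n_def)

lemma ell2_unit_in_ell2n: "k < n \<Longrightarrow> ell2_unit k \<in> ell2n n"
  by (simp add: ell2n_def ell2_unit_nth)

section \<open>Hahn-Banach on a finite-dimensional space\<close>

definition sublinear_on :: "'v::real_vector set \<Rightarrow> ('v \<Rightarrow> real) \<Rightarrow> bool" where
  "sublinear_on V p \<longleftrightarrow> (\<forall>v\<in>V. \<forall>w\<in>V. p (v + w) \<le> p v + p w) \<and>
     (\<forall>v\<in>V. \<forall>r\<ge>0. p (r *\<^sub>R v) = r * p v)"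

lemma sublinear_onI:
  assumes V: "subspace V"
    and add: "\<And>v w. v \<in> V \<Longrightarrow> w \<in> V \<Longrightarrow> p (v + w) \<le> p v + p w"
    and scale: "\<And>r v. v \<in> V \<Longrightarrow> 0 < r \<Longrightarrow> p (r *\<^sub>R v) \<le> r * p v"
    and zero: "p 0 = 0"
  shows "sublinear_on V p"
  unfolding sublinear_on_def
proof (intro conjI ballI allI impI add)
  fix v and r :: real assume v: "v \<in> V" and "0 \<le> r"
  show "p (r *\<^sub>R v) = r * p v"
  proof (cases "r = 0")
    case False
    with \<open>0 \<le> r\<close> have "0 < r" by simp
    with scale[of "r *\<^sub>R v" "inverse r"] scale[of v r] v V show ?thesis
      by (simp add: subspace_scale field_simps)
  qed (simp add: zero)
qed

lemma sublinear_on_sign: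
  assumes "subspace V" "sublinear_on V p" "v \<in> V"
  shows "- p (- v) \<le> p v"
proof -
  have "p (0 *\<^sub>R v) = 0 * p v" using assms unfolding sublinear_on_def by blast
  then have "p 0 = 0" by simp
  moreover have "p (v + - v) \<le> p v + p (- v)"
    using assms subspace_neg[OF assms(1,3)] unfolding sublinear_on_def by blast
  ultimately show ?thesis by simp
qed

text \<open>Take \<open>q v\<close> as the infimum of \<open>p (v + s b) - s p b\<close> over \<open>s \<ge> 0\<close>. It stays sublinear, and the choice
  \<open>s = 1\<close> at \<open>v = - b\<close> gives the last inequality, which forces \<open>q\<close> to be odd in the direction \<open>b\<close>.\<close>

lemma sublinear_descent:
  assumes V: "subspace V" and b: "b \<in> V" and p: "sublinear_on V p"
  obtains q where "sublinear_on V q" "\<And>v. v \<in> V \<Longrightarrow> q v \<le> p v" "q (- b) \<le> - p b"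
proof -
  have p_add: "p (v + w) \<le> p v + p w" if "v \<in> V" "w \<in> V" for v w
    using p that by (simp add: sublinear_on_def)
  have p_scale: "p (r *\<^sub>R v) = r * p v" if "v \<in> V" "0 \<le> r" for r v
    using p that by (simp add: sublinear_on_def)
  have mem: "v + s *\<^sub>R b \<in> V" if "v \<in> V" for v s
    using V b that by (simp add: subspace_add subspace_scale)
  define q where "q v = (INF s\<in>{0..}. p (v + s *\<^sub>R b) - s * p b)" for v
  have lower: "- p (- v) \<le> p (v + s *\<^sub>R b) - s * p b" if "v \<in> V" "0 \<le> s" for v s
  proof -
    have "p ((v + s *\<^sub>R b) + - v) \<le> p (v + s *\<^sub>R b) + p (- v)"
      using that V by (intro p_add mem subspace_neg)
    then show ?thesis using p_scale[OF b that(2)] by simp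
  qed
  have q_le: "q v \<le> p (v + s *\<^sub>R b) - s * p b" if "v \<in> V" "0 \<le> s" for v s
    unfolding q_def using that lower by (intro cINF_lower bdd_belowI2[of _ "- p (- v)"]) auto
  have q_ge: "c \<le> q v" if "\<And>s. 0 \<le> s \<Longrightarrow> c \<le> p (v + s *\<^sub>R b) - s * p b" for c v
    unfolding q_def using that by (intro cINF_greatest) auto
  have "q 0 = 0"
    using q_ge[of 0 0] q_le[of 0 0] p_scale[OF b] p_scale[OF b, of 0] subspace_0[OF V] by simp
  moreover have "q (v + w) \<le> q v + q w" if vw: "v \<in> V" "w \<in> V" for v w
  proof -
    have "q (v + w) \<le> (p (v + s *\<^sub>R b) - s * p b) + (p (w + s' *\<^sub>R b) - s' * p b)"
      if s: "0 \<le> s" "0 \<le> s'" for s s'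
    proof -
      have "q (v + w) \<le> p ((v + w) + (s + s') *\<^sub>R b) - (s + s') * p b"
        using s vw V by (intro q_le) (auto simp: subspace_add)
      also have "(v + w) + (s + s') *\<^sub>R b = (v + s *\<^sub>R b) + (w + s' *\<^sub>R b)"
        by (simp add: algebra_simps)
      also have "p \<dots> \<le> p (v + s *\<^sub>R b) + p (w + s' *\<^sub>R b)" by (intro p_add mem vw)
      finally show ?thesis by (simp add: algebra_simps)
    qed
    then have "q (v + w) - (p (w + s' *\<^sub>R b) - s' * p b) \<le> q v" if "0 \<le> s'" for s'
      using that by (intro q_ge) (auto simp: algebra_simps)
    then have "q (v + w) - q v \<le> q w"
      by (intro q_ge) (auto simp: algebra_simps)
    then show ?thesis by simp
  qed
  moreover have "q (r *\<^sub>R v) \<le> r * q v" if v: "v \<in> V" and r: "0 < r" for r v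
  proof -
    have "q (r *\<^sub>R v) / r \<le> q v"
    proof (rule q_ge)
      fix s :: real assume s: "0 \<le> s"
      have "q (r *\<^sub>R v) \<le> p (r *\<^sub>R v + (r * s) *\<^sub>R b) - (r * s) * p b"
        using v r s V by (intro q_le) (auto simp: subspace_scale)
      also have "r *\<^sub>R v + (r * s) *\<^sub>R b = r *\<^sub>R (v + s *\<^sub>R b)" by (simp add: algebra_simps)
      also have "p \<dots> = r * p (v + s *\<^sub>R b)" using r mem[OF v] by (intro p_scale) auto
      finally show "q (r *\<^sub>R v) / r \<le> p (v + s *\<^sub>R b) - s * p b"
        using r by (simp add: field_simps)
    qed
    then show ?thesis using r by (simp add: field_simps)
  qed
  ultimately have "sublinear_on V q" by (intro sublinear_onI V)
  moreover have "q v \<le> p v" if "v \<in> V" for v using q_le[OF that, of 0] by simp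
  moreover have "q (- b) \<le> - p b"
    using q_le[of "- b" 1] p_scale[OF b, of 0] b V by (simp add: subspace_neg)
  ultimately show thesis by (rule that)
qed

text \<open>Descend once in the direction \<open>t\<close> to fix the value there, then in the direction of each vector of the
  spanning set. Oddness in a direction is inherited by every sublinear minorant, and the directions
  in which a sublinear functional is odd form a subspace, on which the functional is linear.\<close>

lemma hahn_banach_span:
  assumes S: "finite S" and V: "V = span S" and p: "sublinear_on V p" and t: "t \<in> V"
  obtains q where "\<And>v. v \<in> V \<Longrightarrow> q v \<le> p v" "q t = p t"
    "\<And>v w. v \<in> V \<Longrightarrow> w \<in> V \<Longrightarrow> q (v + w) = q v + q w"
    "\<And>v r. v \<in> V \<Longrightarrow> q (r *\<^sub>R v) = r * q v"
proof -
  have sub: "subspace V" by (simp add: V)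
  \<comment> \<open>any later minorant \<open>q\<close> has \<open>q (- t) \<le> - p t\<close>, hence \<open>q t = p t\<close>\<close>
  obtain p' where p': "sublinear_on V p'" "\<And>v. v \<in> V \<Longrightarrow> p' v \<le> p v" "p' (- t) \<le> - p t"
    using sublinear_descent[OF sub t p] by blast
  have "\<exists>q. sublinear_on V q \<and> (\<forall>v\<in>V. q v \<le> p' v) \<and> (\<forall>b\<in>S'. q (- b) \<le> - q b)"
    if "finite S'" "S' \<subseteq> V" for S'
    using that
  proof (induction S' rule: finite_induct)
    case (insert b S')
    then obtain q where q: "sublinear_on V q" "\<forall>v\<in>V. q v \<le> p' v" "\<forall>b\<in>S'. q (- b) \<le> - q b"
      by auto
    have b: "b \<in> V" using insert.prems by simp
    obtain q' where q': "sublinear_on V q'" "\<And>v. v \<in> V \<Longrightarrow> q' v \<le> q v" "q' (- b) \<le> - q b"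
      using sublinear_descent[OF sub b q(1)] by blast
    have "q' (- c) \<le> - q' c" if "c \<in> insert b S'" for c
    proof -
      have c: "c \<in> V" "- c \<in> V" using that insert.prems sub by (auto simp: subspace_neg)
      show ?thesis
        using that q'(3) q'(2)[OF c(1)] q'(2)[OF c(2)] q(3) by fastforce
    qed
    then show ?case using q(2) q'(1,2) by (intro exI[of _ q']) (auto intro: order_trans)
  qed (use p'(1) in auto)
  from this[OF S] obtain q where q: "sublinear_on V q" "\<And>v. v \<in> V \<Longrightarrow> q v \<le> p' v"
    "\<And>b. b \<in> S \<Longrightarrow> q (- b) \<le> - q b" by (auto simp: V span_superset)
  have q_add: "q (v + w) \<le> q v + q w" if "v \<in> V" "w \<in> V" for v w
    using q(1) that by (simp add: sublinear_on_def)
  have q_scale: "q (r *\<^sub>R v) = r * q v" if "v \<in> V" "0 \<le> r" for r v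
    using q(1) that by (simp add: sublinear_on_def)
  note q_sign = sublinear_on_sign[OF sub q(1)]
  have "q 0 = 0" using q_scale[OF t, of 0] by simp
  have neg: "- v \<in> V" if "v \<in> V" for v using sub that by (simp add: subspace_neg)
  have "subspace {v \<in> V. q (- v) \<le> - q v}"
  proof (rule subspaceI)
    show "0 \<in> {v \<in> V. q (- v) \<le> - q v}" using \<open>q 0 = 0\<close> sub by (simp add: subspace_0)
  next
    fix v w assume vw: "v \<in> {v \<in> V. q (- v) \<le> - q v}" "w \<in> {v \<in> V. q (- v) \<le> - q v}"
    then have "v \<in> V" "w \<in> V" by auto
    with vw q_add[of "- v" "- w"] q_add[of v w] neg[of v] neg[of w]
    show "v + w \<in> {v \<in> V. q (- v) \<le> - q v}"
      using sub by (auto simp: subspace_add)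
  next
    fix r v assume v: "v \<in> {v \<in> V. q (- v) \<le> - q v}"
    then have "v \<in> V" "q (- v) \<le> - q v" by auto
    have "q (- (r *\<^sub>R v)) \<le> - q (r *\<^sub>R v)"
    proof (cases "0 \<le> r")
      case True
      with q_scale[of v r] q_scale[of "- v" r] \<open>v \<in> V\<close> neg mult_left_mono[OF \<open>q (- v) \<le> - q v\<close> True]
      show ?thesis by simp
    next
      case False
      with q_scale[of v "- r"] q_scale[of "- v" "- r"] \<open>v \<in> V\<close> neg
        mult_left_mono[OF \<open>q (- v) \<le> - q v\<close>, of "- r"]
      show ?thesis by simp
    qed
    then show "r *\<^sub>R v \<in> {v \<in> V. q (- v) \<le> - q v}"
      using \<open>v \<in> V\<close> sub by (simp add: subspace_scale)
  qed
  then have "V \<subseteq> {v \<in> V. q (- v) \<le> - q v}"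
    unfolding V using q(3) by (intro span_minimal) (auto simp: V span_base)
  then have odd: "q (- v) = - q v" if "v \<in> V" for v
    using that q_sign[of v] by (auto intro: antisym)
  show thesis
  proof (rule that[of q])
    show "q v \<le> p v" if "v \<in> V" for v using q(2) p'(2) that by (blast intro: order_trans)
    show "q t = p t"
      using q(2)[OF t] p'(2)[OF t] q(2)[OF neg[OF t]] p'(3) odd[OF t] by linarith
    show "q (v + w) = q v + q w" if "v \<in> V" "w \<in> V" for v w
      using q_add[of v w] q_add[of "- v" "- w"] that neg odd[of v] odd[of w] odd[of "v + w"] sub
      by (simp add: subspace_add)
    show "q (r *\<^sub>R v) = r * q v" if "v \<in> V" for v r
      using q_scale[of v r] q_scale[of "- v" "- r"] that neg odd[of v] by (cases "0 \<le> r") auto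
  qed
qed

section \<open>Bounded coordinate functionals\<close>

text \<open>For each \<open>i\<close>, the coefficient functions with values in \<open>[-1, 1]\<close> and with value 1 at \<open>i\<close> form a compact
  set in the product topology, on which the continuous norm of the combination does not vanish.
  Dividing arbitrary coefficients by the one of largest modulus reduces to this case.\<close>

lemma independent_norm_lower_bound:
  fixes B :: "'a::real_normed_vector set"
  assumes B: "finite B" "independent B"
  obtains \<delta> where "0 < \<delta>" "\<And>a b. b \<in> B \<Longrightarrow> \<delta> * \<bar>a b\<bar> \<le> norm (\<Sum>b\<in>B. a b *\<^sub>R b)"
proof -
  \<comment> \<open>the factor at \<open>i\<close> is a point and every other factor is an interval; coordinates outside \<open>B\<close> do not
    enter the combination\<close>
  define C :: "'a \<Rightarrow> ('a \<Rightarrow> real) set"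
    where "C i = PiE UNIV (\<lambda>b. if b = i then {1} else {-1..1})" for i
  have compact: "compact (C i)" for i
  proof -
    have "compactin (product_topology (\<lambda>_. euclidean) UNIV) (C i)"
      unfolding C_def by (subst compactin_PiE) simp
    then show ?thesis by (simp add: euclidean_product_topology)
  qed
  have cont: "continuous_on A (\<lambda>a::'a \<Rightarrow> real. norm (\<Sum>b\<in>B. a b *\<^sub>R b))" for A
    by (intro continuous_intros continuous_on_subset[OF continuous_on_product_coordinates]) auto
  have "\<exists>\<delta>>0. \<forall>a\<in>C i. \<delta> \<le> norm (\<Sum>b\<in>B. a b *\<^sub>R b)" if i: "i \<in> B" for i
  proof -
    have "(\<lambda>b. if b = i then 1 else 0) \<in> C i" by (auto simp: C_def)
    then obtain a where a: "a \<in> C i" "\<forall>a'\<in>C i. norm (\<Sum>b\<in>B. a b *\<^sub>R b) \<le> norm (\<Sum>b\<in>B. a' b *\<^sub>R b)"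
      using continuous_attains_inf[OF compact _ cont] by blast
    have "a i \<in> (if i = i then {1} else {-1..1})"
      using a(1) unfolding C_def by (rule PiE_mem) simp
    then have "a i \<noteq> 0" by simp
    then have "(\<Sum>b\<in>B. a b *\<^sub>R b) \<noteq> 0"
      using B i independentD[of B B a i] by auto
    with a(2) show ?thesis
      by (intro exI[of _ "norm (\<Sum>b\<in>B. a b *\<^sub>R b)"]) auto
  qed
  then obtain d where d: "\<And>i. i \<in> B \<Longrightarrow> 0 < d i"
    "\<And>i a. i \<in> B \<Longrightarrow> a \<in> C i \<Longrightarrow> d i \<le> norm (\<Sum>b\<in>B. a b *\<^sub>R b)" by metis
  \<comment> \<open>the 1 keeps the set nonempty when \<open>B\<close> is empty\<close>
  define \<delta> where "\<delta> = Min (insert 1 (d ` B))"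
  have \<delta>: "0 < \<delta>" "\<And>i. i \<in> B \<Longrightarrow> \<delta> \<le> d i"
    using B(1) d(1) by (auto simp: \<delta>_def)
  have "\<delta> * \<bar>a b\<bar> \<le> norm (\<Sum>b\<in>B. a b *\<^sub>R b)" if b: "b \<in> B" for a b
  proof -
    have "Max ((\<lambda>b. \<bar>a b\<bar>) ` B) \<in> (\<lambda>b. \<bar>a b\<bar>) ` B" using B(1) b by (intro Max_in) auto
    then obtain i where i: "i \<in> B" "Max ((\<lambda>b. \<bar>a b\<bar>) ` B) = \<bar>a i\<bar>" by auto
    then have max: "\<bar>a c\<bar> \<le> \<bar>a i\<bar>" if "c \<in> B" for c
      using B(1) that by (metis Max_ge finite_imageI image_eqI)
    have "\<delta> * \<bar>a i\<bar> \<le> norm (\<Sum>b\<in>B. a b *\<^sub>R b)"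
    proof (cases "a i = 0")
      case False
      define a' where "a' c = (if c \<in> B then a c / a i else 0)" for c
      have "\<bar>a' c\<bar> \<le> 1" for c using max False by (auto simp: a'_def abs_divide)
      then have "a' \<in> C i" using i(1) False by (auto simp: C_def a'_def abs_le_iff)
      then have "\<delta> \<le> norm (\<Sum>b\<in>B. a' b *\<^sub>R b)" using d(2) \<delta>(2) i(1) order_trans by blast
      also have "(\<Sum>b\<in>B. a' b *\<^sub>R b) = inverse (a i) *\<^sub>R (\<Sum>b\<in>B. a b *\<^sub>R b)"
        by (simp add: a'_def scaleR_sum_right divide_inverse mult.commute)
      finally show ?thesis using False by (simp add: field_simps)
    qed simp
    then show ?thesis
      using mult_left_mono[OF max[OF b], of \<delta>] \<delta>(1) by linarith
  qed
  with \<delta>(1) show thesis by (rule that)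
qed

text \<open>The coordinate functionals of a basis are continuous. They make every functional on the dual space
  an evaluation at a vector, which is the form of reflexivity that the Grothendieck constants need.\<close>

lemma finite_bounded_coordinates:
  assumes "\<exists>B :: 'a::real_normed_vector set. finite B \<and> span B = UNIV"
  obtains B :: "'a::real_normed_vector set" and c :: "'a \<Rightarrow> 'a \<Rightarrow>\<^sub>L real"
  where "finite B" "card B = dim (UNIV :: 'a::real_normed_vector set)" "span B = UNIV"
    "\<And>x. x = (\<Sum>b\<in>B. blinfun_apply (c b) x *\<^sub>R b)"
proof -
  obtain B0 :: "'a set" where B0: "finite B0" "span B0 = UNIV" using assms by blast
  obtain B :: "'a set" where B: "B \<subseteq> B0" "independent B" "span B = UNIV"
    using B0 by (metis maximal_independent_subset span_eq_iff span_mono subset_UNIV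
        span_subspace subspace_span top.extremum_uniqueI)
  have fin: "finite B" using B0 B(1) finite_subset by blast
  have dim: "card B = dim (UNIV :: 'a set)" using B(2,3) by (metis dim_eq_card_independent dim_span)
  obtain \<delta> where \<delta>: "0 < \<delta>" "\<And>a b. b \<in> B \<Longrightarrow> \<delta> * \<bar>a b\<bar> \<le> norm (\<Sum>b\<in>B. a b *\<^sub>R b)"
    using independent_norm_lower_bound[OF fin B(2)] by blast
  define r where "r b x = representation B x b" for b x
  have expand: "x = (\<Sum>b\<in>B. r b x *\<^sub>R b)" for x
    using sum_representation_eq[of B x B] fin B by (simp add: r_def)
  have "bounded_linear (r b)" if "b \<in> B" for b
  proof (rule bounded_linear_intro[where K = "inverse \<delta>"])
    show "r b (x + y) = r b x + r b y" for x y using B by (simp add: r_def representation_add)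
    show "r b (s *\<^sub>R x) = s *\<^sub>R r b x" for s x using B by (simp add: r_def representation_scale)
    show "norm (r b x) \<le> norm x * inverse \<delta>" for x
      using \<delta>(2)[OF that, of "\<lambda>b. r b x"] \<delta>(1) expand[of x] by (simp add: field_simps)
  qed
  then have "x = (\<Sum>b\<in>B. blinfun_apply (Blinfun (r b)) x *\<^sub>R b)" for x
    by (subst expand) (simp add: bounded_linear_Blinfun_apply)
  from that[OF fin dim B(3) this] show thesis .
qed

section \<open>The projective norm\<close>

lemma proj_norm_le:
  assumes "set ps \<subseteq> S \<times> T"
  shows "proj_norm S T (\<Sum>(x, y)\<leftarrow>ps. x \<otimes> y) \<le> (\<Sum>(x, y)\<leftarrow>ps. norm x * norm y)"
  unfolding proj_norm_def using assms
  by (intro cInf_lower bdd_belowI[of _ 0]) (auto intro!: sum_list_nonneg)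

lemma proj_norm_ge:
  assumes "subspace S" "t \<in> tensor_space S T"
    and "\<And>ps. set ps \<subseteq> S \<times> T \<Longrightarrow> t = (\<Sum>(x, y)\<leftarrow>ps. x \<otimes> y) \<Longrightarrow> c \<le> (\<Sum>(x, y)\<leftarrow>ps. norm x * norm y)"
  shows "c \<le> proj_norm S T t"
  unfolding proj_norm_def using assms tensor_space_representation[OF assms(1,2)]
  by (intro cInf_greatest) auto

lemma subspace_tensor_space: "subspace (tensor_space S T)"
  by (simp add: tensor_space_def)

lemma sublinear_on_proj_norm:
  assumes S: "subspace S"
  shows "sublinear_on (tensor_space S T) (proj_norm S T)"
proof (rule sublinear_onI[OF subspace_tensor_space])
  fix s t assume st: "s \<in> tensor_space S T" "t \<in> tensor_space S T"
  have *: "proj_norm S T (s + t) \<le> (\<Sum>(x, y)\<leftarrow>ps. norm x * norm y) + (\<Sum>(x, y)\<leftarrow>qs. norm x * norm y)"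
    if "set ps \<subseteq> S \<times> T" "s = (\<Sum>(x, y)\<leftarrow>ps. x \<otimes> y)" "set qs \<subseteq> S \<times> T" "t = (\<Sum>(x, y)\<leftarrow>qs. x \<otimes> y)"
    for ps qs
    using proj_norm_le[of "ps @ qs" S T] that by simp
  have "proj_norm S T (s + t) - (\<Sum>(x, y)\<leftarrow>qs. norm x * norm y) \<le> proj_norm S T s"
    if "set qs \<subseteq> S \<times> T" "t = (\<Sum>(x, y)\<leftarrow>qs. x \<otimes> y)" for qs
    using *[OF _ _ that] by (intro proj_norm_ge S st) (auto simp: algebra_simps)
  then have "proj_norm S T (s + t) - proj_norm S T s \<le> proj_norm S T t"
    by (intro proj_norm_ge S st) (auto simp: algebra_simps)
  then show "proj_norm S T (s + t) \<le> proj_norm S T s + proj_norm S T t" by simp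
next
  fix t and r :: real assume t: "t \<in> tensor_space S T" and r: "0 < r"
  have "proj_norm S T (r *\<^sub>R t) / r \<le> proj_norm S T t"
  proof (rule proj_norm_ge[OF S t])
    fix ps assume ps: "set ps \<subseteq> S \<times> T" "t = (\<Sum>(x, y)\<leftarrow>ps. x \<otimes> y)"
    let ?ps = "map (\<lambda>(x, y). (r *\<^sub>R x, y)) ps"
    have "(\<Sum>(x, y)\<leftarrow>?ps. x \<otimes> y) = r *\<^sub>R (\<Sum>(x, y)\<leftarrow>ps. x \<otimes> y)"
      by (induction ps) (auto simp: bilinear_lmul[OF bilinear_tensor_of] scaleR_add_right)
    moreover have "(\<Sum>(x, y)\<leftarrow>?ps. norm x * norm y) = r * (\<Sum>(x, y)\<leftarrow>ps. norm x * norm y)"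
      using r by (induction ps) (auto simp: algebra_simps)
    moreover have "set ?ps \<subseteq> S \<times> T" using ps(1) S by (auto simp: subspace_scale)
    ultimately have "proj_norm S T (r *\<^sub>R t) \<le> r * (\<Sum>(x, y)\<leftarrow>ps. norm x * norm y)"
      using proj_norm_le[of ?ps S T] ps(2) by simp
    then show "proj_norm S T (r *\<^sub>R t) / r \<le> (\<Sum>(x, y)\<leftarrow>ps. norm x * norm y)"
      using r by (simp add: field_simps)
  qed
  then show "proj_norm S T (r *\<^sub>R t) \<le> r * proj_norm S T t" using r by (simp add: field_simps)
next
  have "0 \<le> proj_norm S T 0"
    by (intro proj_norm_ge S subspace_0 subspace_tensor_space) (auto intro!: sum_list_nonneg)
  with proj_norm_le[of "[]" S T] show "proj_norm S T 0 = 0" by simp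
qed

lemma proj_norm_tensor_of_le:
  assumes "x \<in> S" "y \<in> T"
  shows "proj_norm S T (x \<otimes> y) \<le> norm x * norm y"
  using proj_norm_le[of "[(x, y)]" S T] assms by simp

section \<open>Completing squares\<close>

text \<open>Completing the square: write \<open>x\<^sub>i = a\<^sub>i b + \<dots>\<close> and let \<open>w\<close> be the combination of the \<open>x\<^sub>i\<close> with the unit
  coefficient vector \<open>\<beta> = a / |a|\<close>. Replacing each \<open>x\<^sub>i\<close> by \<open>x\<^sub>i - \<beta>\<^sub>i w\<close> removes exactly the one square
  \<open>w \<otimes> w\<close> and eliminates the basis vector \<open>b\<close>, so one square is spent per basis vector.\<close>

lemma sum_squares_reduce:
  assumes "finite B" "finite I" "\<And>i. i \<in> I \<Longrightarrow> x i \<in> span B"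
  shows "\<exists>y. (\<Sum>i\<in>I. x i \<otimes> x i) = (\<Sum>k<card B. y k \<otimes> y k)"
  using assms(1,3)
proof (induction B arbitrary: x rule: finite_induct)
  case empty
  then show ?case by (simp add: bilinear_lzero[OF bilinear_tensor_of])
next
  case (insert b B)
  have "\<exists>k. x i - k *\<^sub>R b \<in> span B" if "i \<in> I" for i
    using insert.prems[OF that] by (simp add: span_breakdown_eq)
  then obtain a where a: "\<And>i. i \<in> I \<Longrightarrow> x i - a i *\<^sub>R b \<in> span B" by metis
  define \<alpha> where "\<alpha> = (\<Sum>i\<in>I. (a i)\<^sup>2)"
  have "0 \<le> \<alpha>" by (simp add: \<alpha>_def sum_nonneg)
  define w where "w = (1 / sqrt \<alpha>) *\<^sub>R (\<Sum>i\<in>I. a i *\<^sub>R x i)"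
  define \<beta> where "\<beta> i = a i / sqrt \<alpha>" for i
  define z where "z i = x i - \<beta> i *\<^sub>R w" for i
  have w: "w = (\<Sum>i\<in>I. \<beta> i *\<^sub>R x i)"
    by (simp add: w_def \<beta>_def scaleR_sum_right)
  note lin = linear_tensor_of
  have "(\<Sum>i\<in>I. x i \<otimes> x i) = (\<Sum>i\<in>I. z i \<otimes> z i) + w \<otimes> w \<and> (\<forall>i\<in>I. z i \<in> span B)"
  proof (cases "\<alpha> = 0")
    case True
    then have "a i = 0" if "i \<in> I" for i
      using that assms(2) by (simp add: \<alpha>_def sum_nonneg_eq_0_iff)
    \<comment> \<open>division by zero makes \<open>w\<close> vanish, and all \<open>x i\<close> already lie in the smaller span\<close>
    moreover have "w = 0" by (simp add: w_def True)
    ultimately show ?thesis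
      using a by (auto simp: z_def bilinear_lzero[OF bilinear_tensor_of])
  next
    case False
    with \<open>0 \<le> \<alpha>\<close> have "0 < \<alpha>" by simp
    have \<beta>2: "(\<Sum>i\<in>I. \<beta> i * \<beta> i) = 1"
      using \<open>0 < \<alpha>\<close>
      by (simp add: \<beta>_def \<alpha>_def[symmetric] power2_eq_square[symmetric] power_divide flip: sum_divide_distrib)
    have wl: "(\<Sum>i\<in>I. \<beta> i *\<^sub>R (x i \<otimes> w)) = w \<otimes> w" "(\<Sum>i\<in>I. \<beta> i *\<^sub>R (w \<otimes> x i)) = w \<otimes> w"
      using linear_sum[OF lin(1), of "\<lambda>i. \<beta> i *\<^sub>R x i" I w] linear_sum[OF lin(2), of w "\<lambda>i. \<beta> i *\<^sub>R x i" I]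
      by (simp_all add: w[symmetric] linear_scale[OF lin(1)] linear_scale[OF lin(2)])
    have "z i \<otimes> z i = x i \<otimes> x i - \<beta> i *\<^sub>R (x i \<otimes> w) - \<beta> i *\<^sub>R (w \<otimes> x i) + (\<beta> i * \<beta> i) *\<^sub>R (w \<otimes> w)" for i
      by (simp add: z_def linear_diff[OF lin(1)] linear_diff[OF lin(2)] linear_scale[OF lin(1)]
          linear_scale[OF lin(2)] algebra_simps)
    then have "(\<Sum>i\<in>I. z i \<otimes> z i) = (\<Sum>i\<in>I. x i \<otimes> x i) - w \<otimes> w"
      by (simp add: sum.distrib sum_subtractf wl \<beta>2 flip: scaleR_sum_left)
    moreover have "z i \<in> span B" if i: "i \<in> I" for i
    proof -
      have "w - sqrt \<alpha> *\<^sub>R b = (\<Sum>j\<in>I. \<beta> j *\<^sub>R (x j - a j *\<^sub>R b))"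
      proof -
        have "(\<Sum>j\<in>I. \<beta> j * a j) = \<alpha> / sqrt \<alpha>"
          by (simp add: \<beta>_def \<alpha>_def power2_eq_square flip: sum_divide_distrib)
        also have "\<dots> = sqrt \<alpha>" using \<open>0 < \<alpha>\<close> by (simp add: real_div_sqrt)
        finally show ?thesis
          by (simp add: w algebra_simps sum_subtractf flip: scaleR_sum_left)
      qed
      then have "w - sqrt \<alpha> *\<^sub>R b \<in> span B"
        using a by (auto intro!: span_sum span_scale)
      then have "(x i - a i *\<^sub>R b) - \<beta> i *\<^sub>R (w - sqrt \<alpha> *\<^sub>R b) \<in> span B"
        by (rule span_diff[OF a[OF i] span_scale])
      moreover have "(x i - a i *\<^sub>R b) - \<beta> i *\<^sub>R (w - sqrt \<alpha> *\<^sub>R b) = z i"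
        using \<open>0 < \<alpha>\<close> by (simp add: z_def \<beta>_def algebra_simps)
      ultimately show ?thesis by simp
    qed
    ultimately show ?thesis by simp
  qed
  moreover from this obtain y where "(\<Sum>i\<in>I. z i \<otimes> z i) = (\<Sum>k<card B. y k \<otimes> y k)"
    using insert.IH[of z] by blast
  ultimately have "(\<Sum>i\<in>I. x i \<otimes> x i) = (\<Sum>k<card (insert b B). (y(card B := w)) k \<otimes> (y(card B := w)) k)"
    using insert.hyps by simp
  then show ?case by blast
qed


section \<open>The constant of positive tensors\<close>

definition positive_pairing_bound :: "'a::real_normed_vector itself \<Rightarrow> real \<Rightarrow> bool" where
  "positive_pairing_bound _ c \<longleftrightarrow> 0 \<le> c \<and>
     (\<forall>(A :: ('a, 'a) tensor) (B :: ('a \<Rightarrow>\<^sub>L real, 'a \<Rightarrow>\<^sub>L real) tensor).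
        tensor_nonneg A \<longrightarrow> tensor_nonneg B \<longrightarrow>
        tensor_pairing A B \<le> c * inj_norm UNIV UNIV A * inj_norm UNIV UNIV B)"

lemma gamma_const_alt:
  "gamma_const TYPE('a::real_normed_vector) = Inf (ennreal ` {c. positive_pairing_bound TYPE('a) c})"
  by (simp add: gamma_const_def positive_pairing_bound_def)

text \<open>The vectors keep a free constant \<open>K\<close> because the 2-summing inequality compares with the weak \<open>\<ell>\<^sub>2\<close> norm
  of an arbitrary finite family.\<close>

lemma positive_pairing_boundD:
  fixes x :: "nat \<Rightarrow> 'a::real_normed_vector" and f :: "nat \<Rightarrow> 'a \<Rightarrow>\<^sub>L real"
  assumes c: "positive_pairing_bound TYPE('a) c"
    and x: "\<And>F :: 'a \<Rightarrow>\<^sub>L real. norm F \<le> 1 \<Longrightarrow> (\<Sum>i<m. (blinfun_apply F (x i))\<^sup>2) \<le> K"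
    and f: "\<And>v. (\<Sum>j<n. (blinfun_apply (f j) v)\<^sup>2) \<le> (norm v)\<^sup>2"
  shows "(\<Sum>i<m. \<Sum>j<n. (blinfun_apply (f j) (x i))\<^sup>2) \<le> c * K"
proof -
  let ?A = "\<Sum>i<m. x i \<otimes> x i" and ?B = "\<Sum>j<n. f j \<otimes> f j"
  have c0: "0 \<le> c" using c by (simp add: positive_pairing_bound_def)
  have A: "inj_norm UNIV UNIV ?A \<le> K"
    using x by (intro inj_norm_sum_squares_le) (auto simp: dual_ball_UNIV)
  have B: "inj_norm UNIV UNIV ?B \<le> 1"
    using f by (intro inj_norm_functional_squares_le) auto
  have A0: "0 \<le> inj_norm UNIV UNIV ?A" and B0: "0 \<le> inj_norm UNIV UNIV ?B"
    by (auto intro!: inj_norm_nonneg simp: tensor_space_UNIV)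
  have "tensor_nonneg ?A" "tensor_nonneg ?B" by (auto simp: tensor_nonneg_iff_sum_squares)
  then have "tensor_pairing ?A ?B \<le> c * inj_norm UNIV UNIV ?A * inj_norm UNIV UNIV ?B"
    using c by (simp add: positive_pairing_bound_def)
  also have "\<dots> \<le> c * K * 1" using c0 A B A0 B0 by (intro mult_mono) auto
  finally show ?thesis by (simp add: tensor_pairing_sum_squares)
qed

text \<open>Both norms can vanish, so the families are divided by the square roots of \<open>\<alpha> + e\<close> and \<open>\<beta> + e\<close> for \<open>e > 0\<close>,
  and \<open>e\<close> tends to 0 at the end.\<close>

lemma positive_pairing_boundI:
  assumes c: "0 \<le> c"
    and normalised: "\<And>(m::nat) (n::nat) (x :: nat \<Rightarrow> 'a::real_normed_vector) (f :: nat \<Rightarrow> 'a \<Rightarrow>\<^sub>L real).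
      (\<And>F :: 'a \<Rightarrow>\<^sub>L real. norm F \<le> 1 \<Longrightarrow> (\<Sum>i<m. (blinfun_apply F (x i))\<^sup>2) \<le> 1) \<Longrightarrow>
      (\<And>v. (\<Sum>j<n. (blinfun_apply (f j) v)\<^sup>2) \<le> (norm v)\<^sup>2) \<Longrightarrow>
      (\<Sum>i<m. \<Sum>j<n. (blinfun_apply (f j) (x i))\<^sup>2) \<le> c"
  shows "positive_pairing_bound TYPE('a) c"
  unfolding positive_pairing_bound_def
proof (intro conjI c allI impI)
  fix A :: "('a, 'a) tensor" and B :: "('a \<Rightarrow>\<^sub>L real, 'a \<Rightarrow>\<^sub>L real) tensor"
  assume "tensor_nonneg A" "tensor_nonneg B"
  then obtain m n :: nat and x f where A: "A = (\<Sum>i<m. x i \<otimes> x i)" and B: "B = (\<Sum>j<n. f j \<otimes> f j)"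
    by (auto simp: tensor_nonneg_iff_sum_squares)
  define \<alpha> where "\<alpha> = inj_norm UNIV UNIV A"
  define \<beta> where "\<beta> = inj_norm UNIV UNIV B"
  have \<alpha>0: "0 \<le> \<alpha>" and \<beta>0: "0 \<le> \<beta>"
    unfolding \<alpha>_def \<beta>_def by (auto intro!: inj_norm_nonneg simp: tensor_space_UNIV)
  have x: "(\<Sum>i<m. (blinfun_apply F (x i))\<^sup>2) \<le> \<alpha>" if "norm F \<le> 1" for F :: "'a \<Rightarrow>\<^sub>L real"
    unfolding \<alpha>_def A using that by (intro inj_norm_sum_squares_ge) (auto simp: dual_ball_UNIV)
  have f: "(\<Sum>j<n. (blinfun_apply (f j) v)\<^sup>2) \<le> \<beta> * (norm v)\<^sup>2" for v
    unfolding \<beta>_def B by (rule inj_norm_functional_squares_ge)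
  have "tensor_pairing A B \<le> c * (\<alpha> + e) * (\<beta> + e)" if e: "0 < e" for e
  proof -
    define x' where "x' i = (1 / sqrt (\<alpha> + e)) *\<^sub>R x i" for i
    define f' where "f' j = (1 / sqrt (\<beta> + e)) *\<^sub>R f j" for j
    have "(\<Sum>i<m. (blinfun_apply F (x' i))\<^sup>2) \<le> 1" if "norm F \<le> 1" for F :: "'a \<Rightarrow>\<^sub>L real"
      using x[OF that] \<alpha>0 e
      by (simp add: x'_def blinfun.scaleR_right power_divide flip: sum_divide_distrib)
    moreover have "(\<Sum>j<n. (blinfun_apply (f' j) v)\<^sup>2) \<le> (norm v)\<^sup>2" for v
    proof -
      have "\<beta> * (norm v)\<^sup>2 \<le> (\<beta> + e) * (norm v)\<^sup>2" using e by (intro mult_right_mono) auto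
      with f[of v] \<beta>0 e show ?thesis
        by (simp add: f'_def blinfun.scaleR_left power_divide divide_le_eq mult.commute
            flip: sum_divide_distrib)
    qed
    ultimately have "(\<Sum>i<m. \<Sum>j<n. (blinfun_apply (f' j) (x' i))\<^sup>2) \<le> c" by (rule normalised)
    moreover have "(blinfun_apply (f' j) (x' i))\<^sup>2 = (blinfun_apply (f j) (x i))\<^sup>2 / ((\<alpha> + e) * (\<beta> + e))" for i j
      using \<alpha>0 \<beta>0 e
      by (simp add: f'_def x'_def blinfun.scaleR_left blinfun.scaleR_right power_divide power_mult_distrib)
    ultimately have "tensor_pairing A B / ((\<alpha> + e) * (\<beta> + e)) \<le> c"
      by (simp add: A B tensor_pairing_sum_squares flip: sum_divide_distrib)
    then show ?thesis using \<alpha>0 \<beta>0 e by (simp add: divide_le_eq mult.assoc)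
  qed
  then have "\<forall>\<^sub>F e in at_right 0. tensor_pairing A B \<le> c * (\<alpha> + e) * (\<beta> + e)"
    by (rule eventually_mono[OF eventually_at_right_less])
  moreover have "((\<lambda>e. c * (\<alpha> + e) * (\<beta> + e)) \<longlongrightarrow> c * (\<alpha> + 0) * (\<beta> + 0)) (at_right 0)"
    by (intro tendsto_intros)
  ultimately have "tensor_pairing A B \<le> c * (\<alpha> + 0) * (\<beta> + 0)"
    by (intro tendsto_lowerbound[OF _ _ trivial_limit_at_right_real])
  then show "tensor_pairing A B \<le> c * inj_norm UNIV UNIV A * inj_norm UNIV UNIV B"
    by (simp add: \<alpha>_def \<beta>_def)
qed

section \<open>The 2-summing norm\<close>

text \<open>The supremum over the dual ball is bounded by the strong \<open>\<ell>\<^sub>2\<close> norm of the family.\<close>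

lemma weak_l2_norm_upper:
  fixes xs :: "'a::real_normed_vector list"
  assumes "norm F \<le> 1"
  shows "sqrt (\<Sum>x\<leftarrow>xs. \<bar>blinfun_apply F x\<bar>\<^sup>2)
    \<le> (SUP f \<in> {f :: 'a \<Rightarrow>\<^sub>L real. norm f \<le> 1}. sqrt (\<Sum>x\<leftarrow>xs. \<bar>blinfun_apply f x\<bar>\<^sup>2))"
proof (rule cSUP_upper)
  have "(\<Sum>x\<leftarrow>xs. \<bar>blinfun_apply f x\<bar>\<^sup>2) \<le> (\<Sum>x\<leftarrow>xs. (norm x)\<^sup>2)" if "norm f \<le> 1" for f :: "'a \<Rightarrow>\<^sub>L real"
  proof (rule sum_list_mono)
    fix x
    have "\<bar>blinfun_apply f x\<bar> \<le> norm x"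
      using norm_blinfun[of f x] mult_right_mono[OF that, of "norm x"] by simp
    then show "\<bar>blinfun_apply f x\<bar>\<^sup>2 \<le> (norm x)\<^sup>2" by (intro power_mono) auto
  qed
  then show "bdd_above ((\<lambda>f. sqrt (\<Sum>x\<leftarrow>xs. \<bar>blinfun_apply f x\<bar>\<^sup>2)) ` {f :: 'a \<Rightarrow>\<^sub>L real. norm f \<le> 1})"
    by (intro bdd_aboveI2[where M = "sqrt (\<Sum>x\<leftarrow>xs. (norm x)\<^sup>2)"]) auto
qed (use assms in simp)

text \<open>The infimum that defines the 2-summing norm is attained: each admissible constant is at least the
  quotient of the two sides. If the weak \<open>\<ell>\<^sub>2\<close> norm is zero, some admissible constant is still needed, and
  finiteness of the 2-summing norm provides one.\<close>

lemma pi2_normD: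
  fixes u :: "'a::real_normed_vector \<Rightarrow>\<^sub>L 'b::real_normed_vector"
  assumes P: "pi2_norm u \<le> ennreal P" "0 \<le> P"
  shows "sqrt (\<Sum>x\<leftarrow>xs. (norm (blinfun_apply u x))\<^sup>2)
    \<le> P * (SUP f \<in> {f :: 'a \<Rightarrow>\<^sub>L real. norm f \<le> 1}. sqrt (\<Sum>x\<leftarrow>xs. \<bar>blinfun_apply f x\<bar>\<^sup>2))"
proof -
  define S where "S xs = (SUP f \<in> {f :: 'a \<Rightarrow>\<^sub>L real. norm f \<le> 1}.
    sqrt (\<Sum>x\<leftarrow>xs. \<bar>blinfun_apply f x\<bar>\<^sup>2))" for xs
  define L where "L xs = sqrt (\<Sum>x\<leftarrow>xs. (norm (blinfun_apply u x))\<^sup>2)" for xs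
  have "0 \<le> S xs"
    unfolding S_def using order_trans[OF _ weak_l2_norm_upper[of 0 xs]] by (simp add: sum_list_nonneg)
  define Cs where "Cs = {C. 0 \<le> C \<and> (\<forall>xs. L xs \<le> C * S xs)}"
  have pi2: "pi2_norm u = Inf (ennreal ` Cs)" by (simp add: pi2_norm_def Cs_def S_def L_def)
  have CsD: "L xs \<le> C * S xs" if "C \<in> Cs" for C using that by (simp add: Cs_def)
  have "L xs \<le> P * S xs"
  proof (cases "S xs = 0")
    case True
    have "Cs \<noteq> {}"
    proof
      assume "Cs = {}"
      then have "pi2_norm u = top" by (simp add: pi2)
      with P(1) show False by (simp add: top_unique)
    qed
    then obtain C where "C \<in> Cs" by blast
    from CsD[OF this] True show ?thesis by simp
  next
    case False
    with \<open>0 \<le> S xs\<close> have S: "0 < S xs" by simp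
    have "ennreal (L xs / S xs) \<le> pi2_norm u"
      unfolding pi2
    proof (rule Inf_greatest)
      fix e assume "e \<in> ennreal ` Cs"
      then obtain C where C: "e = ennreal C" "C \<in> Cs" by blast
      then have "L xs / S xs \<le> C" using CsD[of C] S by (simp add: divide_le_eq)
      then show "ennreal (L xs / S xs) \<le> e" unfolding C(1) by (rule ennreal_leI)
    qed
    also note P(1)
    finally have "L xs / S xs \<le> P" using P(2) by (simp add: ennreal_le_iff)
    then show ?thesis using S by (simp add: divide_le_eq)
  qed
  then show ?thesis by (simp only: L_def S_def)
qed

text \<open>The first \<open>n\<close> coordinate functionals of a contraction into \<open>\<ell>\<^sub>2\<close> are a normalised family for every
  \<open>n\<close>, and the double sums converge to \<open>\<Sum>\<^sub>i \<parallel>u x\<^sub>i\<parallel>\<^sup>2\<close>.\<close>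

lemma pi2_norm_le_sqrt:
  fixes u :: "'a::real_normed_vector \<Rightarrow>\<^sub>L ell2"
  assumes c: "positive_pairing_bound TYPE('a) c" and u: "norm u \<le> 1"
  shows "pi2_norm u \<le> ennreal (sqrt c)"
  unfolding pi2_norm_def
proof (intro Inf_lower imageI CollectI conjI allI)
  have c0: "0 \<le> c" using c by (simp add: positive_pairing_bound_def)
  then show "0 \<le> sqrt c" by simp
  fix xs :: "'a list"
  let ?m = "length xs"
  have list: "(\<Sum>x\<leftarrow>xs. g x) = (\<Sum>i<?m. g (xs ! i))" for g :: "'a \<Rightarrow> real"
    by (simp add: sum_list_sum_nth atLeast0LessThan)
  define S where "S = (SUP f \<in> {f :: 'a \<Rightarrow>\<^sub>L real. norm f \<le> 1}.
    sqrt (\<Sum>x\<leftarrow>xs. \<bar>blinfun_apply f x\<bar>\<^sup>2))"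
  have S: "sqrt (\<Sum>x\<leftarrow>xs. \<bar>blinfun_apply F x\<bar>\<^sup>2) \<le> S" if "norm F \<le> 1" for F
    unfolding S_def by (rule weak_l2_norm_upper[OF that])
  have "0 \<le> S"
    using order_trans[OF _ S[of 0]] by (simp add: sum_list_nonneg)
  define f where "f k = Blinfun (\<lambda>x. ell2_nth (blinfun_apply u x) k)" for k
  have u_le: "(norm (blinfun_apply u v))\<^sup>2 \<le> (norm v)\<^sup>2" for v
    using norm_blinfun[of u v] mult_right_mono[OF u, of "norm v"] by (intro power_mono) auto
  have partial: "(\<Sum>k<n. (ell2_nth z k)\<^sup>2) \<le> (norm z)\<^sup>2" for n z
    using sum_le_suminf[OF sums_summable[OF norm_ell2_sums[of z]], of "{..<n}"]
      sums_unique[OF norm_ell2_sums[of z]] by simp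
  have f: "blinfun_apply (f k) v = ell2_nth (blinfun_apply u v) k" for k v
  proof -
    have "(ell2_nth z k)\<^sup>2 \<le> (norm z)\<^sup>2" for z
      using partial[where n = "Suc k" and z = z] sum_nonneg[of "{..<k}" "\<lambda>k. (ell2_nth z k)\<^sup>2"] by simp
    then have nth_le: "\<bar>ell2_nth z k\<bar> \<le> norm z" for z
      using power2_le_iff_abs_le[of "norm z" "ell2_nth z k"] by simp
    have "bounded_linear (\<lambda>z. ell2_nth z k)"
      by (rule bounded_linear_intro[where K = 1])
        (auto simp: plus_ell2.rep_eq scaleR_ell2.rep_eq nth_le)
    then have "bounded_linear (\<lambda>v. ell2_nth (blinfun_apply u v) k)"
      by (rule bounded_linear_compose[OF _ blinfun.bounded_linear_right])
    then show ?thesis by (simp add: f_def bounded_linear_Blinfun_apply)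
  qed
  have "(\<Sum>i<?m. \<Sum>k<n. (blinfun_apply (f k) (xs ! i))\<^sup>2) \<le> c * S\<^sup>2" for n
  proof (rule positive_pairing_boundD[OF c])
    show "(\<Sum>k<n. (blinfun_apply (f k) v)\<^sup>2) \<le> (norm v)\<^sup>2" for v
      using order_trans[OF partial u_le] by (simp add: f)
    show "(\<Sum>i<?m. (blinfun_apply F (xs ! i))\<^sup>2) \<le> S\<^sup>2" if "norm F \<le> 1" for F :: "'a \<Rightarrow>\<^sub>L real"
      using sqrt_le_D[OF S[OF that]] unfolding list by simp
  qed
  moreover have "(\<lambda>n. \<Sum>i<?m. \<Sum>k<n. (blinfun_apply (f k) (xs ! i))\<^sup>2)
      \<longlonglongrightarrow> (\<Sum>i<?m. (norm (blinfun_apply u (xs ! i)))\<^sup>2)"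
    unfolding f by (intro tendsto_sum norm_ell2_sums[unfolded sums_def])
  ultimately have "(\<Sum>i<?m. (norm (blinfun_apply u (xs ! i)))\<^sup>2) \<le> c * S\<^sup>2"
    by (intro LIMSEQ_le_const2) auto
  then have "sqrt (\<Sum>x\<leftarrow>xs. (norm (blinfun_apply u x))\<^sup>2) \<le> sqrt (c * S\<^sup>2)"
    unfolding list[of "\<lambda>x. (norm (blinfun_apply u x))\<^sup>2"] by (rule real_sqrt_le_mono)
  also have "\<dots> = sqrt c * S"
    using \<open>0 \<le> S\<close> by (simp add: real_sqrt_mult)
  finally show "sqrt (\<Sum>x\<leftarrow>xs. (norm (blinfun_apply u x))\<^sup>2)
    \<le> sqrt c * (SUP f \<in> {f :: 'a \<Rightarrow>\<^sub>L real. norm f \<le> 1}. sqrt (\<Sum>x\<leftarrow>xs. \<bar>blinfun_apply f x\<bar>\<^sup>2))"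
    unfolding S_def .
qed

text \<open>A normalised family of functionals is the family of coordinates of a contraction into \<open>\<ell>\<^sub>2\<close>.\<close>

lemma positive_pairing_bound_of_pi2:
  assumes P: "id_norm_B_Pi2 TYPE('a::real_normed_vector) \<le> ennreal P" "0 \<le> P"
  shows "positive_pairing_bound TYPE('a) (P\<^sup>2)"
proof (rule positive_pairing_boundI)
  fix m n and x :: "nat \<Rightarrow> 'a" and f :: "nat \<Rightarrow> 'a \<Rightarrow>\<^sub>L real"
  assume x: "\<And>F :: 'a \<Rightarrow>\<^sub>L real. norm F \<le> 1 \<Longrightarrow> (\<Sum>i<m. (blinfun_apply F (x i))\<^sup>2) \<le> 1"
    and f: "\<And>v. (\<Sum>j<n. (blinfun_apply (f j) v)\<^sup>2) \<le> (norm v)\<^sup>2"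
  define u where "u = Blinfun (\<lambda>v. ell2_of n (\<lambda>j. blinfun_apply (f j) v))"
  have norm_le: "norm (ell2_of n (\<lambda>j. blinfun_apply (f j) v)) \<le> norm v" for v
    using f[of v] by (rule power2_le_imp_le[OF ord_eq_le_trans[OF norm_ell2_of]]) simp
  have "bounded_linear (\<lambda>v. ell2_of n (\<lambda>j. blinfun_apply (f j) v))"
  proof (rule bounded_linear_intro[where K = 1])
    show "ell2_of n (\<lambda>j. blinfun_apply (f j) (v + w))
        = ell2_of n (\<lambda>j. blinfun_apply (f j) v) + ell2_of n (\<lambda>j. blinfun_apply (f j) w)" for v w
      by (simp add: blinfun.add_right ell2_of_add)
    show "ell2_of n (\<lambda>j. blinfun_apply (f j) (r *\<^sub>R v))
        = r *\<^sub>R ell2_of n (\<lambda>j. blinfun_apply (f j) v)" for r v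
      by (simp add: blinfun.scaleR_right ell2_of_scaleR)
    show "norm (ell2_of n (\<lambda>j. blinfun_apply (f j) v)) \<le> norm v * 1" for v
      unfolding mult_1_right by (rule norm_le)
  qed
  then have u: "blinfun_apply u v = ell2_of n (\<lambda>j. blinfun_apply (f j) v)" for v
    by (simp add: u_def bounded_linear_Blinfun_apply)
  have "norm u \<le> 1"
  proof (rule norm_blinfun_bound)
    show "norm (blinfun_apply u v) \<le> 1 * norm v" for v unfolding u mult_1 by (rule norm_le)
  qed simp
  then have "pi2_norm u \<le> ennreal P"
    by (intro order_trans[OF _ P(1)[unfolded id_norm_B_Pi2_def]] SUP_upper) simp
  note pi2 = pi2_normD[OF this P(2)]
  define xs where "xs = map x [0..<m]"
  have list: "(\<Sum>x\<leftarrow>xs. g x) = (\<Sum>i<m. g (x i))" for g :: "'a \<Rightarrow> real"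
    unfolding xs_def by (induction m) auto
  have "0 \<in> {f :: 'a \<Rightarrow>\<^sub>L real. norm f \<le> 1}" by simp
  then have "{f :: 'a \<Rightarrow>\<^sub>L real. norm f \<le> 1} \<noteq> {}" by blast
  moreover have "sqrt (\<Sum>x\<leftarrow>xs. \<bar>blinfun_apply F x\<bar>\<^sup>2) \<le> 1"
    if "F \<in> {f :: 'a \<Rightarrow>\<^sub>L real. norm f \<le> 1}" for F
    using x[of F] that by (simp add: list)
  ultimately have "(SUP f \<in> {f :: 'a \<Rightarrow>\<^sub>L real. norm f \<le> 1}.
      sqrt (\<Sum>x\<leftarrow>xs. \<bar>blinfun_apply f x\<bar>\<^sup>2)) \<le> 1"
    by (rule cSUP_least)
  from order_trans[OF pi2[of xs] mult_left_mono[OF this P(2)]]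
  have "sqrt (\<Sum>i<m. (norm (blinfun_apply u (x i)))\<^sup>2) \<le> P"
    by (simp add: list)
  then have "(\<Sum>i<m. (norm (blinfun_apply u (x i)))\<^sup>2) \<le> P\<^sup>2" by (rule sqrt_le_D)
  then show "(\<Sum>i<m. \<Sum>j<n. (blinfun_apply (f j) (x i))\<^sup>2) \<le> P\<^sup>2"
    by (simp add: u norm_ell2_of)
qed simp

lemma gamma_const_eq_id_norm_squared:
  "gamma_const TYPE('a::real_normed_vector) = (id_norm_B_Pi2 TYPE('a))\<^sup>2"
proof (rule antisym)
  show "gamma_const TYPE('a) \<le> (id_norm_B_Pi2 TYPE('a))\<^sup>2"
  proof (cases "id_norm_B_Pi2 TYPE('a)")
    case (real P)
    then have "positive_pairing_bound TYPE('a) (P\<^sup>2)"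
      by (intro positive_pairing_bound_of_pi2) auto
    then have "gamma_const TYPE('a) \<le> ennreal (P\<^sup>2)"
      unfolding gamma_const_alt by (intro Inf_lower) auto
    with real show ?thesis by (simp add: ennreal_power)
  qed (simp add: top_power_ennreal)
  show "(id_norm_B_Pi2 TYPE('a))\<^sup>2 \<le> gamma_const TYPE('a)"
    unfolding gamma_const_alt
  proof (rule Inf_greatest)
    fix e assume "e \<in> ennreal ` {c. positive_pairing_bound TYPE('a) c}"
    then obtain c where c: "e = ennreal c" "positive_pairing_bound TYPE('a) c" by blast
    then have c0: "0 \<le> c" by (simp add: positive_pairing_bound_def)
    have "id_norm_B_Pi2 TYPE('a) \<le> ennreal (sqrt c)"
      unfolding id_norm_B_Pi2_def using pi2_norm_le_sqrt[OF c(2)] by (intro SUP_least) auto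
    then have "(id_norm_B_Pi2 TYPE('a))\<^sup>2 \<le> (ennreal (sqrt c))\<^sup>2" by (intro power_mono) auto
    then show "(id_norm_B_Pi2 TYPE('a))\<^sup>2 \<le> e" using c0 by (simp add: ennreal_power c(1))
  qed
qed

section \<open>The positive Grothendieck constant\<close>

text \<open>Evaluating a sum of squares by duality bounds it by the norm of the vector of its terms, which is its
  own square root.\<close>

lemma le_one_of_le_sqrt:
  fixes s :: real
  assumes "0 \<le> s" "s \<le> sqrt s"
  shows "s \<le> 1"
proof (rule ccontr)
  assume "\<not> s \<le> 1"
  then have "sqrt s * 1 < sqrt s * sqrt s" by (intro mult_strict_left_mono) auto
  with assms show False by simp
qed

lemma tensor_space_ell2n_eq_sum:
  assumes "u \<in> tensor_space UNIV (ell2n n)"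
  obtains x where "u = (\<Sum>k<n. x k \<otimes> ell2_unit k)"
proof -
  have "\<exists>x. u = (\<Sum>k<n. x k \<otimes> ell2_unit k)"
    using assms unfolding tensor_space_def
  proof (induction rule: span_induct_alt)
    case base
    show ?case by (rule exI[of _ "\<lambda>_. 0"]) (simp add: bilinear_lzero[OF bilinear_tensor_of])
  next
    case (step c p t)
    then obtain v y x where p: "p = v \<otimes> y" "y \<in> ell2n n" and t: "t = (\<Sum>k<n. x k \<otimes> ell2_unit k)"
      by auto
    note lin = linear_tensor_of(2)
    have "p = (\<Sum>k<n. ell2_nth y k *\<^sub>R (v \<otimes> ell2_unit k))"
      unfolding p(1) by (subst ell2n_eq_sum[OF p(2)]) (simp add: linear_sum[OF lin] linear_scale[OF lin])
    then have "c *\<^sub>R p + t = (\<Sum>k<n. ((c * ell2_nth y k) *\<^sub>R v + x k) \<otimes> ell2_unit k)"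
      by (simp add: t bilinear_ladd[OF bilinear_tensor_of] bilinear_lmul[OF bilinear_tensor_of]
          sum.distrib scaleR_sum_right)
    then show ?case by (rule exI[of _ "\<lambda>k. (c * ell2_nth y k) *\<^sub>R v + x k"])
  qed
  then show thesis using that by blast
qed

lemma tensor_sum_in_tensor_space_ell2n: "(\<Sum>k<n. x k \<otimes> ell2_unit k) \<in> tensor_space UNIV (ell2n n)"
  unfolding tensor_space_def using ell2_unit_in_ell2n by (intro span_sum span_base) auto

lemma tensor_of_ell2_of: "v \<otimes> ell2_of n a = (\<Sum>k<n. a k *\<^sub>R (v \<otimes> ell2_unit k))"
proof -
  note lin = linear_tensor_of(2)
  show ?thesis by (simp add: ell2_of_eq_sum linear_sum[OF lin] linear_scale[OF lin])
qed

text \<open>Test the tensor against the functional on \<open>\<ell>\<^sub>2\<^sup>n\<close> given by the normalised vector with coordinates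
  \<open>f(x\<^sub>k)\<close>.\<close>

lemma weak_l2_le_one_of_inj_norm:
  fixes x :: "nat \<Rightarrow> 'a::real_normed_vector"
  assumes u: "inj_norm UNIV (ell2n n) (\<Sum>k<n. x k \<otimes> ell2_unit k) \<le> 1" and f: "f \<in> dual_ball UNIV"
  shows "(\<Sum>k<n. (f (x k))\<^sup>2) \<le> 1"
proof (cases "(\<Sum>k<n. (f (x k))\<^sup>2) = 0")
  case False
  define z where "z = ell2_of n (\<lambda>k. f (x k))"
  have z2: "(norm z)\<^sup>2 = (\<Sum>k<n. (f (x k))\<^sup>2)" by (simp add: z_def norm_ell2_of)
  with False have z0: "norm z \<noteq> 0" by auto
  define g where "g w = inner z w / norm z" for w
  have "\<bar>g w\<bar> \<le> norm w" for w
    using z0 Cauchy_Schwarz_ineq2[of z w] by (simp add: g_def divide_le_eq mult.commute)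
  then have g: "g \<in> dual_ball (ell2n n)"
    by (auto simp: dual_ball_def g_def inner_add_right add_divide_distrib intro!: linearI)
  then have bil: "bilinear (\<lambda>x y. f x * g y)"
    using f by (simp add: bilinear_functionals dual_ball_def)
  have "inner z (ell2_unit k) = f (x k)" if "k < n" for k
    using that by (simp add: z_def inner_ell2_of ell2_unit_nth of_bool_def if_distrib sum.delta cong: if_cong)
  then have "f (x k) * g (ell2_unit k) = (f (x k))\<^sup>2 / norm z" if "k < n" for k
    using that by (simp add: g_def power2_eq_square)
  then have "tensor_lift (\<lambda>x y. f x * g y) (\<Sum>k<n. x k \<otimes> ell2_unit k) = (norm z)\<^sup>2 / norm z"
    by (simp add: tensor_lift_sum[OF bil] z2 sum_divide_distrib)
  also have "\<dots> = norm z" using z0 by (simp add: power2_eq_square)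
  finally have "norm z \<le> 1"
    using inj_norm_ge[OF subspace_UNIV tensor_sum_in_tensor_space_ell2n f g, of x] u by simp
  then show ?thesis using z2 by (metis norm_ge_zero power_le_one)
qed simp

text \<open>A functional in the dual ball of \<open>\<ell>\<^sub>2\<^sup>n\<close> has square-summable values on the unit vectors, with sum at
  most 1, as one sees by applying it to the vector of these values.\<close>

lemma inj_norm_ell2n_le_one:
  fixes x :: "nat \<Rightarrow> 'a::real_normed_vector"
  assumes x: "\<And>f. f \<in> dual_ball UNIV \<Longrightarrow> (\<Sum>k<n. (f (x k))\<^sup>2) \<le> 1"
  shows "inj_norm UNIV (ell2n n) (\<Sum>k<n. x k \<otimes> ell2_unit k) \<le> 1"
proof (rule inj_norm_le)
  fix f :: "'a \<Rightarrow> real" and g :: "ell2 \<Rightarrow> real"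
  assume f: "f \<in> dual_ball UNIV" and g: "g \<in> dual_ball (ell2n n)"
  then have lin: "linear g" and bil: "bilinear (\<lambda>x y. f x * g y)"
    by (simp_all add: bilinear_functionals dual_ball_def)
  define a where "a k = g (ell2_unit k)" for k
  have "ell2_of n a \<in> ell2n n" by (simp add: ell2n_def ell2_of.rep_eq)
  with g have "\<bar>g (ell2_of n a)\<bar> \<le> norm (ell2_of n a)" by (simp add: dual_ball_def)
  moreover have "g (ell2_of n a) = (\<Sum>k<n. (a k)\<^sup>2)"
    by (simp add: ell2_of_eq_sum linear_sum[OF lin] linear_scale[OF lin] a_def power2_eq_square)
  moreover have "norm (ell2_of n a) = sqrt (\<Sum>k<n. (a k)\<^sup>2)"
    using norm_ell2_of[of n a] by (metis norm_ge_zero real_sqrt_unique)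
  ultimately have "(\<Sum>k<n. (a k)\<^sup>2) \<le> 1"
    by (intro le_one_of_le_sqrt) (auto simp: sum_nonneg)
  with x[OF f] show "\<bar>tensor_lift (\<lambda>x y. f x * g y) (\<Sum>k<n. x k \<otimes> ell2_unit k)\<bar> \<le> 1"
    unfolding tensor_lift_sum[OF bil] a_def by (rule sum_mult_le_sum_squares)
qed

text \<open>Hahn-Banach provides a linear functional \<open>q\<close> that attains the projective norm at \<open>(A \<otimes> id) u\<close> and is
  dominated by it elsewhere. On \<open>g \<otimes> e\<^sub>k\<close> it is the evaluation of \<open>g\<close> at a vector \<open>y\<^sub>k\<close>, and the domination
  on the elementary tensors \<open>F \<otimes> z\<close> says precisely that \<open>(y\<^sub>k)\<close> is normalised.\<close>

lemma proj_norm_le_positive_pairing_bound: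
  fixes A :: "'a::real_normed_vector \<Rightarrow>\<^sub>L ('a \<Rightarrow>\<^sub>L real)"
  assumes finite_dim: "\<exists>B :: 'a set. finite B \<and> span B = UNIV"
    and c: "positive_pairing_bound TYPE('a) c"
    and A: "op_nonneg A" "norm A \<le> 1"
    and u: "u \<in> tensor_space UNIV (ell2n n)" "inj_norm UNIV (ell2n n) u \<le> 1"
  shows "proj_norm UNIV (ell2n n) (tensor_map (blinfun_apply A) id u) \<le> c"
proof -
  obtain B :: "'a set" and e :: "'a \<Rightarrow> 'a \<Rightarrow>\<^sub>L real" where B: "finite B"
    and e: "\<And>x. x = (\<Sum>b\<in>B. blinfun_apply (e b) x *\<^sub>R b)"
    using finite_bounded_coordinates[OF finite_dim] by metis
  have expand: "g = (\<Sum>b\<in>B. blinfun_apply g b *\<^sub>R e b)" for g :: "'a \<Rightarrow>\<^sub>L real"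
  proof (rule blinfun_eqI)
    fix x
    have "blinfun_apply g x = blinfun_apply g (\<Sum>b\<in>B. blinfun_apply (e b) x *\<^sub>R b)"
      by (subst e[of x]) simp
    then show "blinfun_apply g x = blinfun_apply (\<Sum>b\<in>B. blinfun_apply g b *\<^sub>R e b) x"
      by (simp add: blinfun.sum_right blinfun.sum_left blinfun.scaleR_right blinfun.scaleR_left mult.commute)
  qed
  have expand_tensor: "g \<otimes> z = (\<Sum>b\<in>B. blinfun_apply g b *\<^sub>R (e b \<otimes> z))" for g :: "'a \<Rightarrow>\<^sub>L real" and z :: ell2
  proof -
    note lin = linear_tensor_of(1)
    show ?thesis by (subst expand[of g]) (simp add: linear_sum[OF lin] linear_scale[OF lin])
  qed
  define V :: "('a \<Rightarrow>\<^sub>L real, ell2) tensor set" where "V = tensor_space UNIV (ell2n n)"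
  define S where "S = (\<lambda>(b, k). e b \<otimes> ell2_unit k) ` (B \<times> {..<n})"
  have unit_in: "g \<otimes> ell2_unit k \<in> V" if "k < n" for g k
    unfolding V_def tensor_space_def using ell2_unit_in_ell2n[OF that] by (intro span_base) blast
  have "finite S" using B by (simp add: S_def)
  have "V = span S"
  proof (intro subset_antisym subsetI)
    fix t assume "t \<in> V"
    then obtain g where g: "t = (\<Sum>k<n. g k \<otimes> ell2_unit k)"
      using tensor_space_ell2n_eq_sum unfolding V_def by metis
    show "t \<in> span S"
      unfolding g expand_tensor[of "g _"]
      by (intro span_sum span_scale span_base) (auto simp: S_def)
  next
    have "S \<subseteq> V" using unit_in by (auto simp: S_def)
    then show "t \<in> V" if "t \<in> span S" for t
      using that span_minimal[OF _ subspace_tensor_space, of S] by (auto simp: V_def)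
  qed
  obtain x where x: "u = (\<Sum>k<n. x k \<otimes> ell2_unit k)" using tensor_space_ell2n_eq_sum[OF u(1)] .
  define t where "t = tensor_map (blinfun_apply A) id u"
  have t: "t = (\<Sum>k<n. blinfun_apply A (x k) \<otimes> ell2_unit k)"
    by (simp add: t_def x tensor_map_sum linear_blinfun_apply linear_id)
  have "t \<in> V" unfolding t V_def by (rule tensor_sum_in_tensor_space_ell2n)
  obtain q where q_le: "\<And>v. v \<in> V \<Longrightarrow> q v \<le> proj_norm UNIV (ell2n n) v"
    and q_t: "q t = proj_norm UNIV (ell2n n) t"
    and q_add: "\<And>v w. v \<in> V \<Longrightarrow> w \<in> V \<Longrightarrow> q (v + w) = q v + q w"
    and q_scale: "\<And>v r. v \<in> V \<Longrightarrow> q (r *\<^sub>R v) = r * q v"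
    by (rule hahn_banach_span[OF \<open>finite S\<close> \<open>V = span S\<close>
          sublinear_on_proj_norm[OF subspace_UNIV, of "ell2n n", where 'a = "'a \<Rightarrow>\<^sub>L real",
            folded V_def] \<open>t \<in> V\<close>]) blast
  have V: "subspace V" by (simp add: V_def subspace_tensor_space)
  have q_sum: "q (\<Sum>i\<in>I. v i) = (\<Sum>i\<in>I. q (v i))" if "finite I" "\<And>i. i \<in> I \<Longrightarrow> v i \<in> V" for I :: "'i set" and v
    using that
  proof (induction I rule: finite_induct)
    case empty
    show ?case using q_scale[of 0 0] subspace_0[OF V] by simp
  next
    case (insert i I)
    then show ?case by (simp add: q_add subspace_sum[OF V])
  qed
  \<comment> \<open>the vector that represents \<open>g \<mapsto> q (g \<otimes> e\<^sub>k)\<close>, read off from its values on the dual basis\<close>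
  define y where "y k = (\<Sum>b\<in>B. q (e b \<otimes> ell2_unit k) *\<^sub>R b)" for k
  have q_eval: "q (g \<otimes> ell2_unit k) = blinfun_apply g (y k)" if "k < n" for g k
    by (subst expand_tensor)
      (simp add: q_sum B unit_in[OF that] subspace_scale[OF V] q_scale y_def blinfun.sum_right
        blinfun.scaleR_right mult.commute)
  have y1: "(\<Sum>k<n. (blinfun_apply F (y k))\<^sup>2) \<le> 1" if F: "norm F \<le> 1" for F :: "'a \<Rightarrow>\<^sub>L real"
  proof (rule le_one_of_le_sqrt)
    let ?a = "\<lambda>k. blinfun_apply F (y k)"
    have mem: "ell2_of n ?a \<in> ell2n n" by (simp add: ell2n_def ell2_of.rep_eq)
    have "(\<Sum>k<n. (?a k)\<^sup>2) = q (F \<otimes> ell2_of n ?a)"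
      unfolding tensor_of_ell2_of
      by (subst q_sum)
        (simp_all add: unit_in subspace_scale[OF V] q_scale q_eval power2_eq_square)
    also have "\<dots> \<le> proj_norm UNIV (ell2n n) (F \<otimes> ell2_of n ?a)"
      using mem by (intro q_le) (auto simp: V_def tensor_space_def intro: span_base)
    also have "\<dots> \<le> norm F * norm (ell2_of n ?a)" using mem by (intro proj_norm_tensor_of_le) auto
    also have "\<dots> \<le> norm (ell2_of n ?a)" using mult_right_mono[OF F] by fastforce
    also have "\<dots> = sqrt (\<Sum>k<n. (?a k)\<^sup>2)"
      using norm_ell2_of[of n ?a] by (metis norm_ge_zero real_sqrt_unique)
    finally show "(\<Sum>k<n. (?a k)\<^sup>2) \<le> sqrt (\<Sum>k<n. (?a k)\<^sup>2)" .
  qed (simp add: sum_nonneg)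
  have x1: "(\<Sum>k<n. (blinfun_apply F (x k))\<^sup>2) \<le> 1" if "norm F \<le> 1" for F :: "'a \<Rightarrow>\<^sub>L real"
    using weak_l2_le_one_of_inj_norm[of n x "blinfun_apply F"] u(2) that by (auto simp: x dual_ball_UNIV)
  obtain m :: nat and f where f: "A = tensor_op (\<Sum>j<m. f j \<otimes> f j)"
    using A(1) by (auto simp: op_nonneg_def tensor_nonneg_iff_sum_squares)
  \<comment> \<open>evaluating the operator twice at \<open>v\<close> gives the sum of squares\<close>
  have f1: "(\<Sum>j<m. (blinfun_apply (f j) v)\<^sup>2) \<le> (norm v)\<^sup>2" for v
  proof -
    have "(\<Sum>j<m. (blinfun_apply (f j) v)\<^sup>2) = blinfun_apply (blinfun_apply A v) v"
      by (simp add: f tensor_op_sum_squares power2_eq_square)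
    also have "\<dots> \<le> norm (blinfun_apply A v) * norm v"
      using norm_blinfun[of "blinfun_apply A v" v] by simp
    also have "\<dots> \<le> norm v * norm v"
      using norm_blinfun[of A v] mult_right_mono[OF A(2), of "norm v"] by (intro mult_right_mono) auto
    finally show ?thesis by (simp add: power2_eq_square)
  qed
  have "proj_norm UNIV (ell2n n) t = q t" by (rule q_t[symmetric])
  also have "\<dots> = (\<Sum>k<n. blinfun_apply (blinfun_apply A (x k)) (y k))"
    unfolding t by (subst q_sum) (simp_all add: unit_in q_eval)
  also have "\<dots> = (\<Sum>(k, j)\<in>{..<n} \<times> {..<m}. blinfun_apply (f j) (x k) * blinfun_apply (f j) (y k))"
    by (simp add: f tensor_op_sum_squares sum.cartesian_product)
  also have "\<dots> \<le> c"
    using sum_mult_le_sum_squares[of "\<lambda>(k, j). blinfun_apply (f j) (x k)" "{..<n} \<times> {..<m}" c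
        "\<lambda>(k, j). blinfun_apply (f j) (y k)"]
      positive_pairing_boundD[OF c x1 f1] positive_pairing_boundD[OF c y1 f1]
    by (simp add: sum.cartesian_product case_prod_unfold)
  finally show ?thesis by (simp add: t_def)
qed

lemma KG_plus_le_gamma_const:
  assumes "\<exists>B :: 'a::real_normed_vector set. finite B \<and> span B = UNIV"
  shows "KG_plus TYPE('a::real_normed_vector) (ell2n n) \<le> gamma_const TYPE('a)"
  unfolding gamma_const_alt KG_plus_def inj_proj_norm_def
  using proj_norm_le_positive_pairing_bound[OF assms]
  by (intro Inf_greatest SUP_least) (auto intro!: ennreal_leI)

text \<open>The tensor \<open>u\<close> built from the \<open>x\<^sub>k\<close> is admissible, and so is the operator \<open>T\<close> built from the \<open>f\<^sub>j\<close>. The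
  bilinear form \<open>\<phi>\<close> pairs a functional with the \<open>x\<^sub>k\<close> and the result with a sequence; it has norm at
  most 1, so its value on \<open>(T \<otimes> id) u\<close>, which is the double sum, is at most the projective norm.\<close>

lemma normalised_pairing_le_KG_plus:
  fixes x :: "nat \<Rightarrow> 'a::real_normed_vector" and f :: "nat \<Rightarrow> 'a \<Rightarrow>\<^sub>L real"
  assumes K: "KG_plus TYPE('a) (ell2n n) \<le> ennreal K" "0 \<le> K"
    and x: "\<And>F :: 'a \<Rightarrow>\<^sub>L real. norm F \<le> 1 \<Longrightarrow> (\<Sum>k<n. (blinfun_apply F (x k))\<^sup>2) \<le> 1"
    and f: "\<And>v. (\<Sum>j<m. (blinfun_apply (f j) v)\<^sup>2) \<le> (norm v)\<^sup>2"
  shows "(\<Sum>k<n. \<Sum>j<m. (blinfun_apply (f j) (x k))\<^sup>2) \<le> K"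
proof -
  define T where "T = tensor_op (\<Sum>j<m. f j \<otimes> f j)"
  have T: "blinfun_apply (blinfun_apply T v) w = (\<Sum>j<m. blinfun_apply (f j) v * blinfun_apply (f j) w)" for v w
    by (simp add: T_def tensor_op_sum_squares)
  have "op_nonneg T" by (auto simp: T_def op_nonneg_def tensor_nonneg_iff_sum_squares)
  moreover have "norm T \<le> 1"
  proof (intro norm_blinfun_bound)
    fix v w
    have "(blinfun_apply (blinfun_apply T v) w)\<^sup>2 \<le> (norm v)\<^sup>2 * (norm w)\<^sup>2"
      unfolding T by (intro order_trans[OF Cauchy_Schwarz_ineq_sum] mult_mono f) (auto simp: sum_nonneg)
    then have "\<bar>blinfun_apply (blinfun_apply T v) w\<bar> \<le> norm v * norm w"
      by (simp add: power_mult_distrib[symmetric] abs_le_square_iff[symmetric])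
    then show "norm (blinfun_apply (blinfun_apply T v) w) \<le> 1 * norm v * norm w" by simp
  qed auto
  define u where "u = (\<Sum>k<n. x k \<otimes> ell2_unit k)"
  have u: "u \<in> tensor_space UNIV (ell2n n)" "inj_norm UNIV (ell2n n) u \<le> 1"
    unfolding u_def using x
    by (auto intro!: tensor_sum_in_tensor_space_ell2n inj_norm_ell2n_le_one simp: dual_ball_UNIV)
  define t where "t = tensor_map (blinfun_apply T) id u"
  have t: "t = (\<Sum>k<n. blinfun_apply T (x k) \<otimes> ell2_unit k)"
    by (simp add: t_def u_def tensor_map_sum linear_blinfun_apply linear_id)
  have le1: "ennreal (proj_norm UNIV (ell2n n) t) \<le> inj_proj_norm T (ell2n n)"
    unfolding inj_proj_norm_def t_def using u by (intro SUP_upper) auto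
  have le2: "inj_proj_norm T (ell2n n) \<le> KG_plus TYPE('a) (ell2n n)"
    unfolding KG_plus_def using \<open>op_nonneg T\<close> \<open>norm T \<le> 1\<close> by (intro SUP_upper) auto
  have proj_le: "proj_norm UNIV (ell2n n) t \<le> K"
    using order_trans[OF order_trans[OF le1 le2] K(1)] K(2) by (simp add: ennreal_le_iff)
  define \<phi> where "\<phi> F z = inner (ell2_of n (\<lambda>k. blinfun_apply F (x k))) z" for F :: "'a \<Rightarrow>\<^sub>L real" and z
  have bil: "bilinear \<phi>"
    by (intro bilinearI) (auto simp: \<phi>_def ell2_of_eq_sum blinfun.add_left blinfun.scaleR_left
        scaleR_add_left sum.distrib inner_add_left inner_add_right inner_sum_left sum_distrib_left mult.assoc)
  have \<phi>_le: "\<phi> F z \<le> norm F * norm z" for F z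
  proof -
    have "norm (ell2_of n (\<lambda>k. blinfun_apply F (x k))) \<le> norm F"
    proof (cases "F = 0")
      case False
      have "(\<Sum>k<n. (blinfun_apply ((1 / norm F) *\<^sub>R F) (x k))\<^sup>2) \<le> 1" using False by (intro x) simp
      then have "(\<Sum>k<n. (blinfun_apply F (x k))\<^sup>2) \<le> (norm F)\<^sup>2"
        using False by (simp add: blinfun.scaleR_left power_divide divide_le_eq flip: sum_divide_distrib)
      then show ?thesis by (rule power2_le_imp_le[OF ord_eq_le_trans[OF norm_ell2_of]]) simp
    qed (simp add: ell2_of_eq_sum)
    then show ?thesis
      unfolding \<phi>_def by (intro order_trans[OF norm_cauchy_schwarz] mult_right_mono) auto
  qed
  have "tensor_lift \<phi> t \<le> proj_norm UNIV (ell2n n) t"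
  proof (rule proj_norm_ge)
    show "t \<in> tensor_space UNIV (ell2n n)" unfolding t by (rule tensor_sum_in_tensor_space_ell2n)
    fix ps assume "t = (\<Sum>(x, y)\<leftarrow>ps. x \<otimes> y)"
    then show "tensor_lift \<phi> t \<le> (\<Sum>(x, y)\<leftarrow>ps. norm x * norm y)"
      using \<phi>_le by (auto simp: tensor_lift_sum_list[OF bil] intro!: sum_list_mono)
  qed simp
  moreover have "\<phi> F (ell2_unit k) = blinfun_apply F (x k)" if "k < n" for F k
    using that by (simp add: \<phi>_def inner_ell2_of ell2_unit_nth of_bool_def if_distrib sum.delta cong: if_cong)
  then have "tensor_lift \<phi> t = (\<Sum>k<n. \<Sum>j<m. (blinfun_apply (f j) (x k))\<^sup>2)"
    by (simp add: t tensor_lift_sum[OF bil] T power2_eq_square)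
  ultimately show ?thesis using proj_le by simp
qed

text \<open>A positive tensor reduces to \<open>dim E\<close> squares, and zero vectors pad the family to length \<open>n\<close>. The
  quadratic forms on functionals depend only on the tensor, so normalisation and double sum survive.\<close>

lemma gamma_const_le_KG_plus:
  assumes finite_dim: "\<exists>B :: 'a::real_normed_vector set. finite B \<and> span B = UNIV"
    and n: "dim (UNIV :: 'a::real_normed_vector set) \<le> n"
  shows "gamma_const TYPE('a::real_normed_vector) \<le> KG_plus TYPE('a) (ell2n n)"
proof (cases "KG_plus TYPE('a) (ell2n n)")
  case (real K)
  obtain B :: "'a set" where B: "finite B" "card B \<le> n" "span B = UNIV"
    using finite_bounded_coordinates[OF finite_dim] n by metis
  have "positive_pairing_bound TYPE('a) K"
  proof (rule positive_pairing_boundI)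
    fix m l and x :: "nat \<Rightarrow> 'a" and f :: "nat \<Rightarrow> 'a \<Rightarrow>\<^sub>L real"
    assume x: "\<And>F :: 'a \<Rightarrow>\<^sub>L real. norm F \<le> 1 \<Longrightarrow> (\<Sum>i<l. (blinfun_apply F (x i))\<^sup>2) \<le> 1"
      and f: "\<And>v. (\<Sum>j<m. (blinfun_apply (f j) v)\<^sup>2) \<le> (norm v)\<^sup>2"
    obtain y where y: "(\<Sum>i<l. x i \<otimes> x i) = (\<Sum>k<card B. y k \<otimes> y k)"
      using sum_squares_reduce[OF B(1), of "{..<l}" x] B(3) by auto
    define z where "z k = (if k < card B then y k else 0)" for k
    have "(\<Sum>k<n. z k \<otimes> z k) = (\<Sum>k<card B. z k \<otimes> z k)"
      using B(2) by (intro sum.mono_neutral_right) (auto simp: z_def bilinear_lzero[OF bilinear_tensor_of])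
    then have z: "(\<Sum>i<l. x i \<otimes> x i) = (\<Sum>k<n. z k \<otimes> z k)" by (simp add: y z_def)
    have quad: "(\<Sum>i<l. (blinfun_apply F (x i))\<^sup>2) = (\<Sum>k<n. (blinfun_apply F (z k))\<^sup>2)" for F :: "'a \<Rightarrow>\<^sub>L real"
    proof -
      have bil: "bilinear (\<lambda>v w. blinfun_apply F v * blinfun_apply F w)"
        by (simp add: bilinear_functionals linear_blinfun_apply)
      show ?thesis
        using arg_cong[OF z, of "tensor_lift (\<lambda>v w. blinfun_apply F v * blinfun_apply F w)"]
        by (simp add: tensor_lift_sum[OF bil] power2_eq_square)
    qed
    have "(\<Sum>k<n. \<Sum>j<m. (blinfun_apply (f j) (z k))\<^sup>2) \<le> K"
      using real x f by (intro normalised_pairing_le_KG_plus) (auto simp: quad)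
    then show "(\<Sum>i<l. \<Sum>j<m. (blinfun_apply (f j) (x i))\<^sup>2) \<le> K"
      by (subst sum.swap) (subst (asm) sum.swap, simp add: quad)
  qed (use real in simp)
  then show ?thesis unfolding real gamma_const_alt by (intro Inf_lower) auto
qed simp

theorem proposition5p1:
  assumes finite_dim: "\<exists>B :: 'a::banach set. finite B \<and> span B = UNIV"
  shows "gamma_const TYPE('a) = KG_plus TYPE('a) (ell2n (dim (UNIV :: 'a set)))
    \<and> KG_plus TYPE('a) (ell2n (dim (UNIV :: 'a set)))
        = (SUP n \<in> {1::nat..}. KG_plus TYPE('a) (ell2n n))
    \<and> (SUP n \<in> {1::nat..}. KG_plus TYPE('a) (ell2n n)) = (id_norm_B_Pi2 TYPE('a))\<^sup>2"
proof -
  let ?d = "dim (UNIV :: 'a set)"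
  have eq: "KG_plus TYPE('a) (ell2n n) = gamma_const TYPE('a)" if "?d \<le> n" for n
    using KG_plus_le_gamma_const[OF finite_dim] gamma_const_le_KG_plus[OF finite_dim that]
    by (rule antisym)
  have "(SUP n \<in> {1::nat..}. KG_plus TYPE('a) (ell2n n)) = gamma_const TYPE('a)"
  proof (rule antisym)
    show "(SUP n \<in> {1::nat..}. KG_plus TYPE('a) (ell2n n)) \<le> gamma_const TYPE('a)"
      by (intro SUP_least KG_plus_le_gamma_const[OF finite_dim])
    show "gamma_const TYPE('a) \<le> (SUP n \<in> {1::nat..}. KG_plus TYPE('a) (ell2n n))"
      \<comment> \<open>\<open>Suc\<close> keeps the index at least 1 in the zero space\<close>
      using eq[of "Suc ?d"] by (metis SUP_upper atLeast_iff le_add1 le_SucI order_refl plus_1_eq_Suc)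
  qed
  then show ?thesis using eq[of ?d] gamma_const_eq_id_norm_squared[where 'a = 'a] by simp
qed

end
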